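(* Let $\frac{r}{s}>1$ be a rational number, and let $\left[\frac{r}{s}\right]_q=\frac{\mathcal{R}(q)}{\mathcal{S}(q)}$ be the corresponding $q$-rational. Let $M(\mathcal{G}_{\frac rs})$ be the Kasteleyn matrix of the snake graph $\mathcal{G}_{\frac{r}{s}}$, with its edge weights and with the orientation in which colored edges are oriented from black to white and uncolored edges from white to black. Then the determinant of $M(\mathcal{G}_{\frac rs})$ coincides up to a scalar multiple with $\mathcal{R}(q)$, i.e. there exist a sign $\varepsilon\in\{1,-1\}$ and an integer $k$ such that $$\det M\big(\mathcal{G}_{\frac rs}\big)=\varepsilon\, q^{k}\,\mathcal{R}(q).$$
   Context: **Continued fractions.** $[a_1,\ldots,a_k]$ denotes $a_1+\cfrac{1}{a_2+\cfrac{1}{\ddots+\cfrac{1}{a_k}}}$ with integers $a_i\ge 1$. Every rational number $>1$ has exactly one such expansion with $k$ even, and exactly one with $k$ odd; they are related by $[a_1,\ldots,a_k,1]=[a_1,\ldots,a_k+1]$. **$q$-rationals.** Let $q$ be a formal variable. For an integer $a\ge1$ put $[a]_q=1+q+\cdots+q^{a-1}$ and $[a]_{q^{-1}}=1+q^{-1}+\cdots+q^{-(a-1)}$. For $\frac rs=[a_1,\ldots,a_k]>1$ the $q$-rational is the rational function $$\left[\frac{r}{s}\right]_{q}:=[a_1]_{q} + \cfrac{q^{a_{1}}}{[a_2]_{q^{-1}} + \cfrac{q^{-a_{2}}}{[a_{3}]_{q} +\cfrac{q^{a_{3}}}{[a_{4}]_{q^{-1}}+ \cfrac{q^{-a_{4}}}{\ddots}}}},$$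 ending with $[a_k]_q$ if $k$ is odd and with $[a_k]_{q^{-1}}$ if $k$ is even; that is, odd-indexed coefficients appear as $[a_i]_q$ followed by numerator $q^{a_i}$, and even-indexed ones as $[a_i]_{q^{-1}}$ followed by numerator $q^{-a_i}$. It does not depend on the choice of the expansion. It is written as an irreducible fraction $\frac{\mathcal{R}(q)}{\mathcal{S}(q)}$, where $\mathcal{R},\mathcal{S}$ are coprime monic polynomials in $q$ with positive integer coefficients. **Snake graph $\mathcal{G}_{\frac rs}$.** A snake graph is a plane graph formed by unit square boxes $B_1,\ldots,B_d$ of the grid $\mathbb{Z}^2$, together with their vertices and edges, where $B_1$ has lower-left corner $(0,0)$ and each $B_{t+1}$ is glued to $B_t$ either along the east edge of $B_t$ (attached at the right) or along the north edge of $B_t$ (attached on the top). Label edges of boxes by signs as follows: the south and east edges of $B_1$ get $-$ and its north edge gets $+$; and in every box the north and west edges have the same sign, the south and east edges have the same sign, and the north and south edges have opposite signs. The sign sequence of the snake graph starts with the sign $-$ of the south edge of $B_1$, continues with the signs of the $d-1$ edges shared by consecutive boxes $B_t,B_{t+1}$ in order, and ends with the sign of either the north or the east edge of $B_d$ (one chooses which one). For $\frac rs=[a_1,\ldots,a_k]$, $\mathcal{G}_{\frac rs}$ is the snake graph whose sign sequence (for a suitable choice of the last edge) consists of $a_1$ signs $-$, then $a_2$ signs $+$, then $a_3$ signs $-$, and so on, alternating up to $a_k$ equal signs. It has $d=a_1+\cdots+a_k-1$ boxes and does not depend on which of the two expansions of $\frac rs$ is used. **Weights and colors.** An edge on the western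 (respectively southern) border of the snake graph is an edge that belongs to exactly one box and is the west (respectively south) edge of that box. Weights of edges of the snake graph are: - an edge of the western border joining $(x,y)$ to $(x,y+1)$ is colored, with weight $q$ ("blue") if $x+y$ is even and $q^{-1}$ ("red") if $x+y$ is odd; - an edge of the southern border joining $(x,y)$ to $(x+1,y)$ with $x\ge1$ is colored, with weight $q$ ("blue") if $x+y$ is odd and $q^{-1}$ ("red") if $x+y$ is even; - all other edges (including the horizontal edges joining $(0,y)$ to $(1,y)$, all edges shared by two boxes, and the eastern and northern borders) are uncolored and have weight $1$. **Kasteleyn matrix.** The snake graph is bipartite: its vertices are colored black and white so that every edge has endpoints of opposite colors, and the lower-left vertex $(0,0)$ is black. It has the same number $\ell=d+1$ of black and white vertices. Number the black vertices $b_1,\ldots,b_\ell$ and the white vertices $w_1,\ldots,w_\ell$ in any way. Colored edges are oriented from black to white; uncolored edges are oriented from white to black. The Kasteleyn matrix $M(\mathcal{G}_{\frac rs})$ is the $\ell\times\ell$ matrix whose entry $M_{ij}$ is the weight of the edge $b_iw_j$ if this edge exists and is oriented from $b_i$ to $w_j$, minus the weight of this edge if it exists and is oriented from $w_j$ to $b_i$, and $0$ if $b_i$ and $w_j$ are not joined by an edge. *)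

theory Defs
  imports "Jordan_Normal_Form.Determinant"
begin

subsection \<open>Continued fractions\<close>

fun cf_value :: "nat list \<Rightarrow> rat" where
  "cf_value [] = 0"
| "cf_value [a] = of_nat a"
| "cf_value (a # b # as) = of_nat a + 1 / cf_value (b # as)"

definition is_cf_expansion :: "nat list \<Rightarrow> rat \<Rightarrow> bool" where
  "is_cf_expansion as x \<longleftrightarrow> as \<noteq> [] \<and> (\<forall>a\<in>set as. a \<ge> 1) \<and> cf_value as = x"

subsection \<open>q-rationals\<close>

type_synonym ratfun = "int poly fract"

definition q_var :: ratfun where
  "q_var = to_fract [:0, 1:]"

definition q_int :: "ratfun \<Rightarrow> nat \<Rightarrow> ratfun" where
  "q_int t a = (\<Sum>i<a. t ^ i)"

text \<open>The parameter is the formal variable for the first coefficient; it is inverted at each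
  level, so that coefficients alternate between \<open>q\<close> and \<open>q\<inverse>\<close>.\<close>

fun q_cf :: "ratfun \<Rightarrow> nat list \<Rightarrow> ratfun" where
  "q_cf t [] = 0"
| "q_cf t [a] = q_int t a"
| "q_cf t (a # b # as) = q_int t a + t ^ a / q_cf (inverse t) (b # as)"

text \<open>A relation rather than a function of \<open>x\<close>: every rational greater than 1 has two continued
  fraction expansions, and both are admitted.\<close>

definition is_q_rational :: "rat \<Rightarrow> ratfun \<Rightarrow> bool" where
  "is_q_rational x F \<longleftrightarrow> (\<exists>as. is_cf_expansion as x \<and> F = q_cf q_var as)"

definition monic_pos :: "int poly \<Rightarrow> bool" where
  "monic_pos p \<longleftrightarrow> lead_coeff p = 1 \<and> (\<forall>i\<le>degree p. coeff p i > 0)"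

definition is_irreducible_fraction :: "ratfun \<Rightarrow> int poly \<Rightarrow> int poly \<Rightarrow> bool" where
  "is_irreducible_fraction F R S \<longleftrightarrow>
     F = to_fract R / to_fract S \<and> coprime R S \<and> monic_pos R \<and> monic_pos S"

subsection \<open>Snake graphs\<close>

text \<open>A box is given by its lower-left corner, an edge by the set of its two endpoints, and a snake
  graph by the list of its boxes in order.\<close>

type_synonym vertex = "int \<times> int"
type_synonym edge = "vertex set"
type_synonym snake = "vertex list"

fun hedge :: "vertex \<Rightarrow> edge" where
  "hedge (x, y) = {(x, y), (x + 1, y)}"

fun vedge :: "vertex \<Rightarrow> edge" where
  "vedge (x, y) = {(x, y), (x, y + 1)}"

fun move_right :: "vertex \<Rightarrow> vertex" where
  "move_right (x, y) = (x + 1, y)"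

fun move_up :: "vertex \<Rightarrow> vertex" where
  "move_up (x, y) = (x, y + 1)"

definition south :: "vertex \<Rightarrow> edge" where "south B = hedge B"
definition north :: "vertex \<Rightarrow> edge" where "north B = hedge (move_up B)"
definition west :: "vertex \<Rightarrow> edge" where "west B = vedge B"
definition east :: "vertex \<Rightarrow> edge" where "east B = vedge (move_right B)"

definition box_edges :: "vertex \<Rightarrow> edge set" where
  "box_edges B = {south B, north B, west B, east B}"

definition is_snake :: "snake \<Rightarrow> bool" where
  "is_snake G \<longleftrightarrow> G \<noteq> [] \<and> hd G = (0, 0) \<and>
     (\<forall>t. Suc t < length G \<longrightarrow> G ! Suc t = move_right (G ! t) \<or> G ! Suc t = move_up (G ! t))"

definition edges :: "snake \<Rightarrow> edge set" where
  "edges G = (\<Union>B\<in>set G. box_edges B)"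

definition vertices :: "snake \<Rightarrow> vertex set" where
  "vertices G = \<Union> (edges G)"

subsubsection \<open>Sign sequences\<close>

datatype sign = Minus | Plus

fun opp :: "sign \<Rightarrow> sign" where
  "opp Minus = Plus"
| "opp Plus = Minus"

definition is_sign_labelling :: "snake \<Rightarrow> (edge \<Rightarrow> sign) \<Rightarrow> bool" where
  "is_sign_labelling G \<sigma> \<longleftrightarrow>
     \<sigma> (south (hd G)) = Minus \<and> \<sigma> (east (hd G)) = Minus \<and> \<sigma> (north (hd G)) = Plus \<and>
     (\<forall>B\<in>set G. \<sigma> (north B) = \<sigma> (west B) \<and> \<sigma> (south B) = \<sigma> (east B) \<and> \<sigma> (north B) \<noteq> \<sigma> (south B))"

text \<open>The edge shared by a box \<open>B\<close> and its successor \<open>B'\<close>.\<close>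

definition shared_edge :: "vertex \<Rightarrow> vertex \<Rightarrow> edge" where
  "shared_edge B B' = (if B' = move_right B then east B else north B)"

definition sign_sequence :: "snake \<Rightarrow> (edge \<Rightarrow> sign) \<Rightarrow> edge \<Rightarrow> sign list" where
  "sign_sequence G \<sigma> e =
     \<sigma> (south (hd G)) # map (\<lambda>(B, B'). \<sigma> (shared_edge B B')) (zip G (tl G)) @ [\<sigma> e]"

fun sign_blocks :: "sign \<Rightarrow> nat list \<Rightarrow> sign list" where
  "sign_blocks s [] = []"
| "sign_blocks s (a # as) = replicate a s @ sign_blocks (opp s) as"

definition is_snake_graph_of :: "rat \<Rightarrow> snake \<Rightarrow> bool" where
  "is_snake_graph_of x G \<longleftrightarrow> is_snake G \<and>
     (\<exists>as \<sigma> e. is_cf_expansion as x \<and> is_sign_labelling G \<sigma> \<and> e \<in> {north (last G), east (last G)} \<and>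
        sign_sequence G \<sigma> e = sign_blocks Minus as)"

subsection \<open>Colors and weights of edges\<close>

definition in_one_box :: "snake \<Rightarrow> edge \<Rightarrow> bool" where
  "in_one_box G e \<longleftrightarrow> card {B \<in> set G. e \<in> box_edges B} = 1"

definition western_border :: "snake \<Rightarrow> edge set" where
  "western_border G = {west B | B. B \<in> set G \<and> in_one_box G (west B)}"

definition southern_border :: "snake \<Rightarrow> edge set" where
  "southern_border G = {south B | B. B \<in> set G \<and> in_one_box G (south B)}"

definition blue :: "snake \<Rightarrow> edge set" where
  "blue G = {vedge (x, y) | x y. vedge (x, y) \<in> western_border G \<and> even (x + y)} \<union>
            {hedge (x, y) | x y. hedge (x, y) \<in> southern_border G \<and> x \<ge> 1 \<and> odd (x + y)}"

definition red :: "snake \<Rightarrow> edge set" where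
  "red G = {vedge (x, y) | x y. vedge (x, y) \<in> western_border G \<and> odd (x + y)} \<union>
           {hedge (x, y) | x y. hedge (x, y) \<in> southern_border G \<and> x \<ge> 1 \<and> even (x + y)}"

definition colored :: "snake \<Rightarrow> edge set" where
  "colored G = blue G \<union> red G"

definition weight :: "snake \<Rightarrow> edge \<Rightarrow> ratfun" where
  "weight G e = (if e \<in> blue G then q_var else if e \<in> red G then inverse q_var else 1)"

subsection \<open>The Kasteleyn matrix\<close>

text \<open>Every edge joins lattice points of opposite coordinate parity and the graph is connected, so
  parity is the only proper 2-coloring of the vertices in which \<open>(0, 0)\<close> is black.\<close>

definition black :: "snake \<Rightarrow> vertex set" where
  "black G = {v \<in> vertices G. even (fst v + snd v)}"

definition white :: "snake \<Rightarrow> vertex set" where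
  "white G = {v \<in> vertices G. odd (fst v + snd v)}"

text \<open>A pair \<open>(u, v)\<close> stands for the edge \<open>{u, v}\<close> oriented from \<open>u\<close> to \<open>v\<close>.\<close>

definition oriented_edges :: "snake \<Rightarrow> (vertex \<times> vertex) set" where
  "oriented_edges G =
     {(u, v). u \<in> black G \<and> v \<in> white G \<and> {u, v} \<in> colored G} \<union>
     {(u, v). u \<in> white G \<and> v \<in> black G \<and> {u, v} \<in> edges G - colored G}"

definition kasteleyn_matrix ::
    "snake \<Rightarrow> nat \<Rightarrow> (nat \<Rightarrow> vertex) \<Rightarrow> (nat \<Rightarrow> vertex) \<Rightarrow> ratfun mat" where
  "kasteleyn_matrix G l b w = mat l l (\<lambda>(i, j).
     if (b i, w j) \<in> oriented_edges G then weight G {b i, w j}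
     else if (w j, b i) \<in> oriented_edges G then - weight G {b i, w j}
     else 0)"

end

theory Submission
  imports Defs
begin

text \<open>
Snake graphs are built by gluing one box at a time, and the proof follows two numbers through this
process: the determinant of the Kasteleyn matrix, and its cofactor at the edge along which the next
box will be glued.

A new box brings one new black and one new white vertex, so the matrix grows by one row and one
column that are zero except for three entries: \<open>- 1\<close> in the corner (the edge opposite to the glued
edge) and the two edges next to the glued edge, one of them colored with weight \<open>t\<close>, the other one
uncolored with entry \<open>- 1\<close>. Hence determinant \<open>P\<close> and cofactor \<open>Q\<close> at the glued edge turn into the
determinant \<open>t * Q - P\<close>, and the cofactor at the next glued edge is \<open>P\<close> if that edge is opposite to
the previous one and \<open>- t * Q\<close> if it is the uncolored side edge (\<open>det_and_cofactor_attach_box\<close>). Gluing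
never happens along the colored side.

The sign labelling records exactly the data that this recursion needs. The colored edge of a box has
weight \<open>q\<close> if the edge along which the box is glued is labelled \<open>-\<close>, and weight \<open>1 / q\<close> if it is
labelled \<open>+\<close>; and the label changes from one glued edge to the next precisely when the two edges are
opposite in their box. So determinant and cofactor depend on the sign sequence only, through the
two-term recursion \<open>sweep\<close> (\<open>det_and_cofactor_snake\<close>).

Along a block of \<open>a\<close> equal signs the first number accumulates a geometric sum, and at the change of
sign the second number is replaced by the first one of the step before. This is the recursion of the
continued fraction, read from its front: the result of sweeping over the blocks \<open>a\<^sub>1, \<dots>, a\<^sub>k\<close> is the \<open>q\<close>-continuant \<open>N\<close> of these numbers
(\<open>sweep_sign_blocks\<close>), and the \<open>q\<close>-rational is \<open>N / D\<close> with \<open>D\<close> the continuant, in \<open>1 / q\<close>, of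
\<open>a\<^sub>2, \<dots>, a\<^sub>k\<close> (\<open>q_cf_eq_quotient\<close>). The \<open>q\<close>-rational may have been computed from the other expansion
of the same number, which gives the same function (\<open>q_cf_determined_by_value\<close>).

It remains to compare \<open>N\<close> with the numerator \<open>R\<close> of the irreducible fraction. Both continuants are
Laurent polynomials, and unrolling the recursion as in Euclid's algorithm gives a Bezout identity
between them (\<open>q_continuant_Bezout\<close>). So \<open>N\<close> and \<open>R\<close> divide each other in the ring of Laurent
polynomials, whose units are \<open>\<plusminus> q\<^sup>k\<close> (\<open>irreducible_numerator_unique\<close>).
\<close>

section \<open>The q-continuant of a continued fraction\<close>

text \<open>The numerator of \<open>q_cf\<close> before any cancellation. At \<open>t = 1\<close> it is Euler's continuant.\<close>

fun q_continuant :: "ratfun \<Rightarrow> nat list \<Rightarrow> ratfun" where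
  "q_continuant t [] = 1"
| "q_continuant t [a] = q_int t a"
| "q_continuant t (a # b # as) =
     q_int t a * q_continuant (inverse t) (b # as) + t ^ a * q_continuant t as"

lemma q_var_pos: "q_var > 0"
proof -
  have "(0 :: int poly) < [:0, 1:]"
    by (simp add: less_poly_def pos_poly_pCons)
  then show ?thesis
    by (simp add: q_var_def to_fract_def zero_less_Fract_iff)
qed

lemma q_int_pos: "t > 0 \<Longrightarrow> a \<ge> 1 \<Longrightarrow> q_int t a > 0"
  unfolding q_int_def by (intro sum_pos) (auto simp: lessThan_empty_iff)

lemma q_continuant_pos:
  assumes "t > 0" "\<forall>a\<in>set as. a \<ge> 1"
  shows "q_continuant t as > 0"
  using assms
  by (induction t as rule: q_continuant.induct)
     (auto intro!: q_int_pos add_pos_pos mult_pos_pos)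

text \<open>Numerator and denominator shift: the denominator of the continued fraction that starts at \<open>a\<close> is the
numerator of the one that starts at the next coefficient, whose parameter is \<open>inverse t\<close>. Positivity
in the ordered field of rational functions keeps all denominators away from zero.\<close>

lemma q_cf_eq_quotient:
  assumes "t > 0" "\<forall>b\<in>set (a # as). b \<ge> 1"
  shows "q_cf t (a # as) = q_continuant t (a # as) / q_continuant (inverse t) as"
  using assms
proof (induction as arbitrary: t a)
  case Nil
  then show ?case by simp
next
  case (Cons b as)
  have "q_continuant (inverse t) (b # as) > 0" "q_continuant t as > 0"
    using Cons.prems by (auto intro!: q_continuant_pos)
  moreover have "q_cf (inverse t) (b # as) = q_continuant (inverse t) (b # as) / q_continuant t as"
    using Cons.IH[of "inverse t" b] Cons.prems by simp
  ultimately show ?case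
    by (simp add: add_divide_distrib)
qed

lemma cf_value_ge_1:
  assumes "as \<noteq> []" "\<forall>a\<in>set as. a \<ge> 1"
  shows "cf_value as \<ge> 1"
  using assms
proof (induction as rule: cf_value.induct)
  case (3 a b as)
  then have "cf_value (b # as) \<ge> 1" by simp
  then have "1 / cf_value (b # as) \<ge> 0" by simp
  moreover have "(of_nat a :: rat) \<ge> 1" using 3 by simp
  ultimately show ?case unfolding cf_value.simps by linarith
qed auto

lemma cf_value_eq_1_iff:
  assumes "as \<noteq> []" "\<forall>a\<in>set as. a \<ge> 1"
  shows "cf_value as = 1 \<longleftrightarrow> as = [1]"
proof (cases as rule: cf_value.cases)
  case (3 a b bs)
  then have "cf_value (b # bs) \<ge> 1" using assms by (intro cf_value_ge_1) auto
  then have "1 / cf_value (b # bs) > 0" by simp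
  moreover have "(of_nat a :: rat) \<ge> 1" using 3 assms by simp
  ultimately have "cf_value as > 1" unfolding 3 cf_value.simps by linarith
  then show ?thesis using 3 by auto
qed (use assms in auto)

lemma nat_plus_fraction_unique:
  fixes u v :: rat
  assumes "of_nat m + u = of_nat n + v" "0 \<le> u" "u < 1" "0 \<le> v" "v < 1"
  shows "m = n \<and> u = v"
proof -
  have "\<lfloor>of_nat m + u\<rfloor> = int m" "\<lfloor>of_nat n + v\<rfloor> = int n"
    using assms(2-5) by (auto intro!: floor_unique)
  then have "m = n"
    using assms(1) by simp
  then show ?thesis using assms(1) by simp
qed

lemma q_cf_merge_one:
  assumes "t > 0"
  shows "q_cf t [a, 1] = q_cf t [a + 1]"
  using assms by (simp add: q_int_def)

text \<open>The integer part of the value determines the first coefficient, and the fractional part determines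
the value of the tail, unless the tail is the single coefficient 1, whose contribution \<open>1 / 1\<close> is not
a proper fraction. Such a tail is first merged into the preceding coefficient, which shortens the
list; this is why the induction is on the total length.\<close>

lemma q_cf_determined_by_value:
  assumes "t > 0" "as \<noteq> []" "bs \<noteq> []" "\<forall>a\<in>set as. a \<ge> 1" "\<forall>b\<in>set bs. b \<ge> 1"
    and "cf_value as = cf_value bs"
  shows "q_cf t as = q_cf t bs"
  using assms
proof (induction "length as + length bs" arbitrary: as bs t rule: less_induct)
  case less
  obtain a as' b bs' where as: "as = a # as'" and bs: "bs = b # bs'"
    using less.prems(2,3) by (metis neq_Nil_conv)
  \<comment> \<open>What the tail adds to the first coefficient, with value 0 for the empty tail.\<close>
  define frac where "frac cs = (if cs = [] then 0 else 1 / cf_value cs)" for cs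
  have val: "cf_value (c # cs) = of_nat c + frac cs" for c cs
    by (cases cs) (auto simp: frac_def)
  have frac: "0 \<le> frac cs \<and> frac cs < 1" if "cs \<noteq> [1]" "\<forall>c\<in>set cs. c \<ge> 1" for cs
  proof (cases "cs = []")
    case False
    then have "cf_value cs > 1"
      using cf_value_ge_1[of cs] cf_value_eq_1_iff[of cs] that by linarith
    then show ?thesis using False by (simp add: frac_def)
  qed (simp add: frac_def)
  consider "as' = [1]" | "bs' = [1]" | "as' \<noteq> [1]" "bs' \<noteq> [1]" by blast
  then show ?case
  proof cases
    case 1
    have "q_cf t [a + 1] = q_cf t bs"
      by (rule less.hyps) (use less.prems 1 as in auto)
    then show ?thesis
      using q_cf_merge_one[OF less.prems(1)] as 1 by simp
  next
    case 2
    have "q_cf t as = q_cf t [b + 1]"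
      by (rule less.hyps) (use less.prems 2 bs in auto)
    then show ?thesis
      using q_cf_merge_one[OF less.prems(1)] bs 2 by simp
  next
    case 3
    have eq: "a = b \<and> frac as' = frac bs'"
      using less.prems as bs val frac[OF 3(1)] frac[OF 3(2)]
      by (intro nat_plus_fraction_unique) auto
    have pos: "cs \<noteq> [] \<Longrightarrow> \<forall>c\<in>set cs. c \<ge> 1 \<Longrightarrow> cf_value cs > 0" for cs
      using cf_value_ge_1[of cs] by linarith
    show ?thesis
    proof (cases "as' = [] \<or> bs' = []")
      case True
      then have "as' = [] \<and> bs' = []"
        using eq pos[of as'] pos[of bs'] less.prems as bs by (auto simp: frac_def split: if_splits)
      then show ?thesis using eq as bs by simp
    next
      case False
      have "q_cf (inverse t) as' = q_cf (inverse t) bs'"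
        by (rule less.hyps) (use less.prems as bs False eq in \<open>auto simp: frac_def\<close>)
      moreover obtain c cs d ds where "as' = c # cs" "bs' = d # ds"
        using False by (metis neq_Nil_conv)
      ultimately show ?thesis using eq as bs by simp
    qed
  qed
qed

section \<open>Laurent polynomials and irreducible numerators\<close>

definition laurent :: "ratfun set" where
  "laurent = {to_fract p * q_var powi k | p k. True}"

lemma q_var_nonzero: "q_var \<noteq> 0"
  using q_var_pos by simp

lemma q_var_powi_add: "q_var powi (k + m) = q_var powi k * q_var powi m"
  by (rule power_int_add) (simp add: q_var_nonzero)

lemma to_fract_power: "to_fract (p ^ n) = to_fract p ^ n"
  by (induction n) auto

text \<open>The lower one of the two powers of \<open>q\<close> can be factored out, leaving a polynomial.\<close>

lemma laurent_add:
  assumes "f \<in> laurent" "g \<in> laurent"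
  shows "f + g \<in> laurent"
proof -
  have *: "to_fract p * q_var powi k + to_fract r * q_var powi m \<in> laurent" if "k \<le> m" for p r k m
  proof -
    have "q_var powi m = q_var powi k * to_fract ([:0, 1:] ^ nat (m - k))"
      using that q_var_nonzero
      by (simp add: to_fract_power flip: q_var_def power_int_add power_int_of_nat)
    then have "to_fract p * q_var powi k + to_fract r * q_var powi m =
        to_fract (p + r * [:0, 1:] ^ nat (m - k)) * q_var powi k"
      by (simp add: algebra_simps)
    then show ?thesis unfolding laurent_def by blast
  qed
  obtain p k r m where "f = to_fract p * q_var powi k" "g = to_fract r * q_var powi m"
    using assms unfolding laurent_def by blast
  then show ?thesis
    using *[of k m p r] *[of m k r p] by (cases "k \<le> m") (auto simp: add.commute)
qed

lemma laurent_mult: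
  assumes "f \<in> laurent" "g \<in> laurent"
  shows "f * g \<in> laurent"
proof -
  obtain p k r m where "f = to_fract p * q_var powi k" "g = to_fract r * q_var powi m"
    using assms unfolding laurent_def by blast
  then have "f * g = to_fract (p * r) * q_var powi (k + m)"
    using q_var_nonzero by (simp add: power_int_add)
  then show ?thesis unfolding laurent_def by blast
qed

lemma to_fract_laurent: "to_fract p \<in> laurent"
  unfolding laurent_def by (auto intro!: exI[of _ p] exI[of _ "0::int"])

lemma laurent_powi: "q_var powi k \<in> laurent"
  unfolding laurent_def by (auto intro!: exI[of _ "1::int poly"])

lemma laurent_uminus: "f \<in> laurent \<Longrightarrow> - f \<in> laurent"
  using laurent_mult[OF to_fract_laurent[of "-1"]] by simp

lemma laurent_diff: "f \<in> laurent \<Longrightarrow> g \<in> laurent \<Longrightarrow> f - g \<in> laurent"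
  using laurent_add[OF _ laurent_uminus] by simp

definition q_unit :: "ratfun \<Rightarrow> bool" where
  "q_unit t \<longleftrightarrow> t = q_var \<or> t = inverse q_var"

lemma q_unit_inverse: "q_unit t \<Longrightarrow> q_unit (inverse t)"
  unfolding q_unit_def by auto

lemma q_unit_pos: "q_unit t \<Longrightarrow> t > 0"
  unfolding q_unit_def using q_var_pos by auto

lemma q_unit_power_laurent:
  assumes "q_unit t"
  shows "t ^ n \<in> laurent"
  using assms laurent_powi[of "int n"] laurent_powi[of "- int n"]
  unfolding q_unit_def by (auto simp: power_int_minus power_inverse)

lemma q_int_laurent:
  assumes "q_unit t"
  shows "q_int t a \<in> laurent"
proof (induction a)
  case 0
  show ?case using to_fract_laurent[of 0] by (simp add: q_int_def)
next
  case (Suc a)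
  then show ?case
    using laurent_add q_unit_power_laurent[OF assms] by (simp add: q_int_def)
qed

lemma q_continuant_laurent: "q_unit t \<Longrightarrow> q_continuant t as \<in> laurent"
  by (induction t as rule: q_continuant.induct)
     (use to_fract_laurent[of 1] in \<open>auto intro!: laurent_add laurent_mult q_int_laurent
        q_unit_power_laurent q_unit_inverse\<close>)

text \<open>The recursion expresses each continuant by the next two, and the coefficient \<open>t ^ a\<close> of the last one
is a unit among Laurent polynomials. So a Bezout identity for a tail can be carried one step outwards,
starting from the empty continuant 1.\<close>

lemma q_continuant_Bezout:
  assumes "q_unit t"
  shows "\<exists>U\<in>laurent. \<exists>V\<in>laurent.
    U * q_continuant t (a # as) + V * q_continuant (inverse t) as = 1"
  using assms
proof (induction as arbitrary: t a)
  case Nil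
  show ?case
    using to_fract_laurent[of 0] to_fract_laurent[of 1]
    by (intro bexI[of _ 0] bexI[of _ 1]) auto
next
  case (Cons b as)
  let ?N = "q_continuant (inverse t) (b # as)" and ?T = "q_continuant t as"
  obtain U V where UV: "U \<in> laurent" "V \<in> laurent" "U * ?N + V * ?T = 1"
    using Cons.IH[OF q_unit_inverse[OF Cons.prems], of b] by auto
  let ?W = "inverse t ^ a"
  have W: "?W * t ^ a = 1"
    using q_unit_pos[OF Cons.prems] by (simp add: power_inverse)
  have "V * ?W * q_continuant t (a # b # as) + (U - V * ?W * q_int t a) * ?N
      = U * ?N + V * (?W * t ^ a) * ?T"
    by (simp add: algebra_simps)
  then have "V * ?W * q_continuant t (a # b # as) + (U - V * ?W * q_int t a) * ?N = 1"
    using UV(3) W by simp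
  moreover have "V * ?W \<in> laurent" "U - V * ?W * q_int t a \<in> laurent"
    using UV Cons.prems
    by (auto intro!: laurent_diff laurent_mult q_unit_power_laurent q_unit_inverse q_int_laurent)
  ultimately show ?case by blast
qed

lemma is_unit_int_poly:
  fixes p :: "int poly"
  assumes "p dvd 1"
  shows "p = 1 \<or> p = -1"
proof -
  obtain c where "p = [:c:]" "c = 1 \<or> c = -1"
    using assms by (auto simp: is_unit_poly_iff abs_if split: if_splits)
  moreover have "[:- 1:] = (- 1 :: int poly)"
    by (metis minus_pCons minus_zero one_pCons)
  ultimately show ?thesis
    by (auto simp flip: one_pCons)
qed

text \<open>Multiplying the two polynomial parts gives a power of the prime element \<open>q\<close>, and every divisor of
such a power is again a power up to a unit of \<open>\<int>[q]\<close>, that is up to sign.\<close>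

lemma laurent_units:
  assumes "f \<in> laurent" "g \<in> laurent" "f * g = 1"
  shows "\<exists>\<epsilon>\<in>{1, -1}. \<exists>k::int. f = \<epsilon> * q_var powi k"
proof -
  obtain p k r m where f: "f = to_fract p * q_var powi k" and g: "g = to_fract r * q_var powi m"
    using assms unfolding laurent_def by blast
  define X :: "int poly" where "X = [:0, 1:]"
  have X: "to_fract X = q_var" by (simp add: X_def q_var_def)
  \<comment> \<open>One of the two exponents is 0; the other one clears the power of \<open>q\<close> in whichever direction it occurs.\<close>
  define i j where "i = nat (- (k + m))" and "j = nat (k + m)"
  have "to_fract (p * r) * q_var powi (k + m) = 1"
    using assms(3) q_var_nonzero by (simp add: f g power_int_add ac_simps)
  moreover have "q_var powi (k + m) * q_var powi int i = q_var powi int j"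
    unfolding q_var_powi_add[symmetric] by (cases "k + m \<ge> 0") (auto simp: i_def j_def)
  ultimately have "to_fract (p * r) * q_var ^ j = q_var ^ i"
    by (metis mult.assoc mult_1 power_int_of_nat)
  then have "to_fract (p * r * X ^ j) = to_fract (X ^ i)"
    by (simp add: to_fract_power X)
  then have "p * (r * X ^ j) = X ^ i"
    by (simp only: to_fract_eq_iff mult.assoc)
  then have "p dvd X ^ i"
    by (metis dvd_triv_left)
  moreover have "prime_elem X"
    unfolding X_def by (rule prime_elem_linear_poly) auto
  then have "prime X"
    by (simp add: prime_def X_def normalize_poly_def flip: one_pCons)
  ultimately obtain n where "normalize p = normalize (X ^ n)"
    using divides_primepow_weak by blast
  then obtain u where "u dvd 1" "p = u * X ^ n"
    by (rule associatedE1)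
  then have "p = X ^ n \<or> p = - (X ^ n)"
    using is_unit_int_poly[of u] by auto
  then have "f = q_var powi (int n + k) \<or> f = - (q_var powi (int n + k))"
    using q_var_nonzero by (auto simp: f to_fract_power X power_int_add)
  then show ?thesis by auto
qed

text \<open>Cross-multiplication gives \<open>R * D = N * S\<close>. Coprimality of \<open>R\<close> and \<open>S\<close> in \<open>\<int>[q]\<close> makes \<open>R\<close> a divisor
of \<open>N\<close>, and the Bezout identity for \<open>N\<close> and \<open>D\<close> makes \<open>N\<close> a divisor of \<open>R\<close>, both up to powers of \<open>q\<close>.
The two quotients are then mutually inverse Laurent polynomials.\<close>

lemma irreducible_numerator_unique:
  assumes "N \<in> laurent" "D \<in> laurent" "U \<in> laurent" "V \<in> laurent" "U * N + V * D = 1"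
    and "D \<noteq> 0" "S \<noteq> 0" "coprime R S" "N / D = to_fract R / to_fract S"
  shows "\<exists>\<epsilon>\<in>{1, -1}. \<exists>k::int. N = \<epsilon> * q_var powi k * to_fract R"
proof (cases "R = 0")
  case True
  then show ?thesis using assms by auto
next
  case False
  have cross: "to_fract R * D = N * to_fract S"
    using assms(6,7,9) by (simp add: field_simps)
  define X :: "int poly" where "X = [:0, 1:]"
  have X: "to_fract X = q_var" by (simp add: X_def q_var_def)
  obtain p k r m where N: "N = to_fract p * q_var powi k" and D: "D = to_fract r * q_var powi m"
    using assms(1,2) unfolding laurent_def by blast
  \<comment> \<open>The shifts by \<open>i\<close> and \<open>j\<close> (one of them 0) bring both sides to the same power of \<open>q\<close>, so that the
    equation can be read in \<open>\<int>[q]\<close>.\<close>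
  define i j where "i = nat (k - m)" and "j = nat (m - k)"
  have ij: "q_var ^ j * q_var powi k = q_var ^ i * q_var powi m"
    using q_var_nonzero
    by (simp add: i_def j_def flip: power_int_add power_int_of_nat)
  have "to_fract (R * r * X ^ j) * q_var powi k = to_fract R * (q_var ^ j * q_var powi k) * to_fract r"
    by (simp add: to_fract_power X)
  also have "\<dots> = q_var ^ i * (to_fract R * D)"
    unfolding ij D by simp
  also have "\<dots> = to_fract (p * X ^ i * S) * q_var powi k"
    unfolding cross N by (simp add: to_fract_power X)
  finally have "to_fract (R * r * X ^ j) = to_fract (p * X ^ i * S)"
    using q_var_nonzero by simp
  then have "R * (r * X ^ j) = p * X ^ i * S"
    by (simp only: to_fract_eq_iff mult.assoc)
  then have "R dvd p * X ^ i * S"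
    by (metis dvd_triv_left)
  then obtain y where y: "p * X ^ i = R * y"
    using assms(8) by (auto simp: coprime_dvd_mult_left_iff)
  define Y where "Y = to_fract y * q_var powi (k - int i)"
  have "Y \<in> laurent" unfolding Y_def laurent_def by blast
  have "to_fract R * Y = to_fract (p * X ^ i) * q_var powi (k - int i)"
    unfolding y Y_def by simp
  also have "\<dots> = to_fract p * (q_var powi (int i) * q_var powi (k - int i))"
    by (simp add: to_fract_power X)
  also have "\<dots> = N"
    unfolding N q_var_powi_add[symmetric] by simp
  finally have NY: "N = to_fract R * Y" ..
  define Z where "Z = U * to_fract R + V * to_fract S"
  have "Z \<in> laurent"
    unfolding Z_def using assms by (intro laurent_add laurent_mult to_fract_laurent)
  have "to_fract R = to_fract R * (U * N + V * D)"
    using assms(5) by simp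
  also have "\<dots> = U * N * to_fract R + V * (to_fract R * D)"
    by (simp add: algebra_simps)
  also have "\<dots> = N * Z"
    unfolding cross Z_def by (simp add: algebra_simps)
  finally have "to_fract R * (Y * Z) = to_fract R * 1"
    unfolding NY by (simp add: ac_simps)
  then have "Y * Z = 1"
    using False by (simp only: mult_cancel_left to_fract_eq_0_iff) auto
  then show ?thesis
    using laurent_units[OF \<open>Y \<in> laurent\<close> \<open>Z \<in> laurent\<close>] NY by (auto simp: ac_simps)
qed

section \<open>Determinants of bordered matrices\<close>

text \<open>The determinant is affine in each entry, with the cofactor as slope. Cofactors are computed below by
comparing two determinants that differ in one entry.\<close>

lemma det_add_entry:
  fixes A :: "'a :: comm_ring_1 mat"
  assumes A: "A \<in> carrier_mat n n" and "i < n" "j < n"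
  shows "det (mat n n (\<lambda>(k, l). A $$ (k, l) + (if k = i \<and> l = j then x else 0)))
    = det A + x * cofactor A i j" (is "det ?B = _")
proof -
  have "cofactor ?B k j = cofactor A k j" if "k < n" for k
  proof -
    have "mat_delete ?B k j = mat_delete A k j"
      using A assms(3) that by (intro eq_matI) (auto simp: mat_delete_def)
    then show ?thesis by (simp add: cofactor_def)
  qed
  then have "det ?B = (\<Sum>k<n. (A $$ (k, j) + (if k = i then x else 0)) * cofactor A k j)"
    using assms(3) by (subst laplace_expansion_column[of _ n j]) auto
  also have "\<dots> = (\<Sum>k<n. A $$ (k, j) * cofactor A k j) + (\<Sum>k<n. if k = i then x * cofactor A k j else 0)"
    by (simp add: distrib_right sum.distrib if_distrib[of "\<lambda>c. c * _"] cong: if_cong)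
  also have "\<dots> = det A + x * cofactor A i j"
    using laplace_expansion_column[OF A assms(3)] assms(2) by simp
  finally show ?thesis .
qed

text \<open>The shape that a Kasteleyn matrix takes when a box is glued along the edge in position \<open>(i, j)\<close>: the
corner is the opposite edge, \<open>\<alpha>\<close> and \<open>\<beta>\<close> are the two side edges.\<close>

definition bordered :: "'a :: ring_1 mat \<Rightarrow> nat \<Rightarrow> nat \<Rightarrow> nat \<Rightarrow> 'a \<Rightarrow> 'a \<Rightarrow> 'a mat" where
  "bordered A n i j \<alpha> \<beta> = mat (Suc n) (Suc n) (\<lambda>(k, l).
     if k < n then (if l < n then A $$ (k, l) else if k = i then \<beta> else 0)
     else (if l < n then (if l = j then \<alpha> else 0) else - 1))"

text \<open>Adding \<open>\<beta>\<close> times the last row to row \<open>i\<close> clears the last column above the corner \<open>- 1\<close>, at the price of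
adding \<open>\<alpha> * \<beta>\<close> to the entry \<open>(i, j)\<close>.\<close>

lemma det_bordered:
  fixes A :: "'a :: idom mat"
  assumes A: "A \<in> carrier_mat n n" and "i < n" "j < n"
  shows "det (bordered A n i j \<alpha> \<beta>) = - det A - \<alpha> * \<beta> * cofactor A i j"
proof -
  define B where "B = mat n n (\<lambda>(k, l). A $$ (k, l) + (if k = i \<and> l = j then \<alpha> * \<beta> else 0))"
  define C where "C = mat 1 n (\<lambda>(k, l). if l = j then \<alpha> else 0)"
  have "det (bordered A n i j \<alpha> \<beta>) = det (addrow \<beta> i n (bordered A n i j \<alpha> \<beta>))"
    using assms(2) by (subst det_addrow[of n "Suc n"]) (auto simp: bordered_def)
  also have "addrow \<beta> i n (bordered A n i j \<alpha> \<beta>) = four_block_mat B (0\<^sub>m n 1) C (- 1\<^sub>m 1)"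
    using assms(2,3) by (intro eq_matI) (auto simp: bordered_def B_def C_def)
  also have "det \<dots> = det B * det (- 1\<^sub>m 1 :: 'a mat)"
    by (rule det_four_block_mat_upper_right_zero_col[of _ n]) (auto simp: B_def C_def)
  also have "det (- 1\<^sub>m 1 :: 'a mat) = - 1"
    by (subst det_single) auto
  also have "det B = det A + \<alpha> * \<beta> * cofactor A i j"
    unfolding B_def by (rule det_add_entry[OF assms])
  finally show ?thesis by simp
qed

lemma cofactor_bordered_corner:
  assumes "A \<in> carrier_mat n n"
  shows "cofactor (bordered A n i j \<alpha> \<beta>) n n = det A"
proof -
  have "mat_delete (bordered A n i j \<alpha> \<beta>) n n = A"
    using assms by (intro eq_matI) (auto simp: mat_delete_def bordered_def)
  then show ?thesis by (simp add: cofactor_def)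
qed

text \<open>Raising \<open>\<alpha>\<close> by 1 changes the determinant by the cofactor at that entry.\<close>

lemma cofactor_bordered_row:
  fixes A :: "'a :: idom mat"
  assumes A: "A \<in> carrier_mat n n" and "i < n" "j < n"
  shows "cofactor (bordered A n i j \<alpha> \<beta>) n j = - \<beta> * cofactor A i j"
proof -
  let ?M = "bordered A n i j"
  have "?M (\<alpha> + 1) \<beta> = mat (Suc n) (Suc n) (\<lambda>(k, l). ?M \<alpha> \<beta> $$ (k, l) + (if k = n \<and> l = j then 1 else 0))"
    using assms by (intro eq_matI) (auto simp: bordered_def)
  then have "det (?M (\<alpha> + 1) \<beta>) = det (?M \<alpha> \<beta>) + 1 * cofactor (?M \<alpha> \<beta>) n j"
    using assms by (simp only:) (rule det_add_entry, auto simp: bordered_def)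
  then show ?thesis
    unfolding det_bordered[OF assms] by (simp add: algebra_simps)
qed

lemma cofactor_bordered_col:
  fixes A :: "'a :: idom mat"
  assumes A: "A \<in> carrier_mat n n" and "i < n" "j < n"
  shows "cofactor (bordered A n i j \<alpha> \<beta>) i n = - \<alpha> * cofactor A i j"
proof -
  let ?M = "bordered A n i j"
  have "?M \<alpha> (\<beta> + 1) = mat (Suc n) (Suc n) (\<lambda>(k, l). ?M \<alpha> \<beta> $$ (k, l) + (if k = i \<and> l = n then 1 else 0))"
    using assms by (intro eq_matI) (auto simp: bordered_def)
  then have "det (?M \<alpha> (\<beta> + 1)) = det (?M \<alpha> \<beta>) + 1 * cofactor (?M \<alpha> \<beta>) i n"
    using assms by (simp only:) (rule det_add_entry, auto simp: bordered_def)
  then show ?thesis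
    unfolding det_bordered[OF assms] by (simp add: algebra_simps)
qed

section \<open>Attaching a box to a weighted bipartite graph\<close>

text \<open>The Kasteleyn matrix for a single function \<open>f\<close> that combines adjacency, orientation and weight, with
value 0 on non-edges. Gluing a box then is a function update.\<close>

definition edge_matrix :: "(edge \<Rightarrow> 'a) \<Rightarrow> nat \<Rightarrow> (nat \<Rightarrow> vertex) \<Rightarrow> (nat \<Rightarrow> vertex) \<Rightarrow> 'a mat" where
  "edge_matrix f n b w = mat n n (\<lambda>(i, j). f {b i, w j})"

lemma bij_betw_permutes:
  fixes n :: nat
  assumes "bij_betw b {..<n} B" "bij_betw b' {..<n} B"
  obtains p where "p permutes {0..<n}" "\<And>i. i < n \<Longrightarrow> b i = b' (p i)"
proof -
  define p where "p i = (if i < n then inv_into {..<n} b' (b i) else i)" for i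
  have "bij_betw (inv_into {..<n} b' \<circ> b) {..<n} {..<n}"
    using assms bij_betw_inv_into bij_betw_trans by blast
  then have "bij_betw p {..<n} {..<n}"
    by (rule bij_betw_cong[THEN iffD1, rotated]) (auto simp: p_def)
  then have "p permutes {0..<n}"
    unfolding atLeast0LessThan by (rule bij_imp_permutes) (auto simp: p_def)
  moreover have "b i = b' (p i)" if "i < n" for i
    using that assms by (auto simp: p_def bij_betw_def intro!: f_inv_into_f[symmetric])
  ultimately show ?thesis by (rule that)
qed

text \<open>Renumbering permutes rows and columns. This reduces the theorem to one numbering, which can be
extended box by box.\<close>

lemma det_edge_matrix_renumber:
  fixes f :: "edge \<Rightarrow> 'a :: comm_ring_1"
  assumes "bij_betw b {..<n} B" "bij_betw b' {..<n} B" "bij_betw w {..<n} W" "bij_betw w' {..<n} W"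
  shows "\<exists>\<epsilon>\<in>{1, -1}. det (edge_matrix f n b w) = \<epsilon> * det (edge_matrix f n b' w')"
proof -
  obtain p where p: "p permutes {0..<n}" "\<And>i. i < n \<Longrightarrow> b i = b' (p i)"
    using bij_betw_permutes[OF assms(1,2)] by metis
  obtain r where r: "r permutes {0..<n}" "\<And>i. i < n \<Longrightarrow> w i = w' (r i)"
    using bij_betw_permutes[OF assms(3,4)] by metis
  have lt: "p i < n" "r i < n" if "i < n" for i
    using permutes_in_image[OF p(1)] permutes_in_image[OF r(1)] that by auto
  have rows: "det (edge_matrix f n b v) = signof p * det (edge_matrix f n b' v)" for v
  proof -
    have "edge_matrix f n b v = mat n n (\<lambda>(i, j). edge_matrix f n b' v $$ (p i, j))"
      using p(2) lt by (intro eq_matI) (auto simp: edge_matrix_def)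
    then show ?thesis
      by (simp only:) (rule det_permute_rows[OF _ p(1)], simp add: edge_matrix_def)
  qed
  have "det (edge_matrix f n b' w) = det (transpose_mat (edge_matrix f n b' w))"
    by (subst det_transpose[of _ n]) (auto simp: edge_matrix_def)
  also have "transpose_mat (edge_matrix f n b' w)
      = mat n n (\<lambda>(i, j). transpose_mat (edge_matrix f n b' w') $$ (r i, j))"
    using r(2) lt by (intro eq_matI) (auto simp: edge_matrix_def)
  also have "det \<dots> = signof r * det (transpose_mat (edge_matrix f n b' w'))"
    by (rule det_permute_rows[OF _ r(1)]) (simp add: edge_matrix_def)
  also have "det (transpose_mat (edge_matrix f n b' w')) = det (edge_matrix f n b' w')"
    by (subst det_transpose[of _ n]) (auto simp: edge_matrix_def)
  finally have "det (edge_matrix f n b w) = signof p * signof r * det (edge_matrix f n b' w')"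
    using rows[of w] by (simp add: mult.assoc)
  moreover have "signof p * signof r \<in> {1, -1 :: 'a}"
    by (auto simp: sign_def)
  ultimately show ?thesis by blast
qed

abbreviation even_points :: "vertex set \<Rightarrow> vertex set" where
  "even_points V \<equiv> {v \<in> V. even (fst v + snd v)}"

abbreviation odd_points :: "vertex set \<Rightarrow> vertex set" where
  "odd_points V \<equiv> {v \<in> V. odd (fst v + snd v)}"

text \<open>The numbering is hidden behind an existential quantifier, so that gluing a box can extend it by one
black and one white vertex. Quantities for different edges \<open>e\<close> may come from different numberings,
which is harmless because each of them starts its own chain of gluings.\<close>

definition det_and_cofactor ::
    "(edge \<Rightarrow> 'a :: comm_ring_1) \<Rightarrow> vertex set \<Rightarrow> edge \<Rightarrow> 'a \<Rightarrow> 'a \<Rightarrow> bool" where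
  "det_and_cofactor f V e P Q \<longleftrightarrow> (\<exists>n b w i j.
     bij_betw b {..<n} (even_points V) \<and> bij_betw w {..<n} (odd_points V) \<and>
     i < n \<and> j < n \<and> e = {b i, w j} \<and>
     det (edge_matrix f n b w) = P \<and> cofactor (edge_matrix f n b w) i j = Q)"

lemma det_and_cofactorI:
  assumes "bij_betw b {..<n} (even_points V)" "bij_betw w {..<n} (odd_points V)"
    and "i < n" "j < n" "e = {b i, w j}"
    and "det (edge_matrix f n b w) = P" "cofactor (edge_matrix f n b w) i j = Q"
  shows "det_and_cofactor f V e P Q"
  using assms unfolding det_and_cofactor_def by blast

lemma bij_betw_extend:
  assumes "bij_betw b {..<n} B" "x \<notin> B"
  shows "bij_betw (b(n := x)) {..<Suc n} (insert x B)"
proof -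
  have "bij_betw (b(n := x)) {..<n} B"
    using assms(1) by (rule bij_betw_cong[THEN iffD1, rotated]) auto
  then have "bij_betw (b(n := x)) ({..<n} \<union> {n}) (B \<union> {x})"
    by (rule bij_betw_combine) (use assms(2) in \<open>auto simp: bij_betw_def\<close>)
  moreover have "{..<n} \<union> {n} = {..<Suc n}" by auto
  ultimately show ?thesis by simp
qed

text \<open>Here \<open>x\<close>, \<open>y\<close> are the black and white end of the glued edge and \<open>x'\<close>, \<open>y'\<close> the new black and white
vertices; \<open>c\<close> is the colored side edge and \<open>u\<close> the uncolored one. The new matrix is the old one
bordered by the entries of \<open>c\<close> and \<open>u\<close>, whose product is \<open>- t\<close> whichever of them lies in the new row.
The cofactors at the opposite edge \<open>{x', y'}\<close> and at \<open>u\<close> are those needed for gluing the next box.\<close>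

lemma det_and_cofactor_attach_box:
  fixes f :: "edge \<Rightarrow> 'a :: idom"
  assumes old: "det_and_cofactor f V {x, y} P Q"
    and support: "\<And>e. f e \<noteq> 0 \<Longrightarrow> e \<subseteq> V"
    and parity: "even (fst x + snd x)" "odd (fst y + snd y)"
      "even (fst x' + snd x')" "odd (fst y' + snd y')"
    and new: "x' \<notin> V" "y' \<notin> V"
    and sides: "(c, u) = ({x', y}, {x, y'}) \<or> (c, u) = ({x, y'}, {x', y})"
    and g: "g = f(c := t, u := - 1, {x', y'} := - 1)" and V': "V' = insert x' (insert y' V)"
  shows "det_and_cofactor g V' {x', y'} (t * Q - P) P"
    and "det_and_cofactor g V' u (t * Q - P) (- t * Q)"
proof -
  obtain n b w i j where b: "bij_betw b {..<n} (even_points V)"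
    and w: "bij_betw w {..<n} (odd_points V)" and ij: "i < n" "j < n" "{x, y} = {b i, w j}"
    and P: "det (edge_matrix f n b w) = P" and Q: "cofactor (edge_matrix f n b w) i j = Q"
    using old unfolding det_and_cofactor_def by blast
  have bV: "b k \<in> V" "even (fst (b k) + snd (b k))" if "k < n" for k
    using b that by (auto simp: bij_betw_def)
  have wV: "w k \<in> V" "odd (fst (w k) + snd (w k))" if "k < n" for k
    using w that by (auto simp: bij_betw_def)
  have xy: "x = b i" "y = w j"
    using ij bV[of i] wV[of j] parity(1,2) by (auto simp: doubleton_eq_iff)
  have xyV: "x \<in> V" "y \<in> V" using bV(1) wV(1) ij xy by auto
  have b_eq: "b k = x \<longleftrightarrow> k = i" if "k < n" for k
    using b that ij(1) unfolding xy by (auto simp: bij_betw_def inj_on_def)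
  have w_eq: "w k = y \<longleftrightarrow> k = j" if "k < n" for k
    using w that ij(2) unfolding xy by (auto simp: bij_betw_def inj_on_def)
  define \<alpha> where "\<alpha> = g {x', y}"
  define \<beta> where "\<beta> = g {x, y'}"
  define b' where "b' = b(n := x')"
  define w' where "w' = w(n := y')"
  have neq: "x \<noteq> y'" "x' \<noteq> y" "x' \<noteq> y'" "x \<noteq> y" "x' \<noteq> x" "y' \<noteq> y"
    using parity new xyV by auto
  have b': "bij_betw b' {..<Suc n} (even_points V')"
  proof -
    have "even_points V' = insert x' (even_points V)" using parity unfolding V' by auto
    then show ?thesis unfolding b'_def using bij_betw_extend[OF b, of x'] new by simp
  qed
  have w': "bij_betw w' {..<Suc n} (odd_points V')"
  proof -
    have "odd_points V' = insert y' (odd_points V)" using parity unfolding V' by auto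
    then show ?thesis unfolding w'_def using bij_betw_extend[OF w, of y'] new by simp
  qed
  have cu: "{c, u} = {{x', y}, {x, y'}}" using sides by auto
  have g_old: "g {b k, w l} = f {b k, w l}" if "k < n" "l < n" for k l
  proof -
    have "{b k, w l} \<notin> {c, u}" "{b k, w l} \<noteq> {x', y'}"
      unfolding cu using bV[OF that(1)] wV[OF that(2)] new by (auto simp: doubleton_eq_iff)
    then show ?thesis unfolding g by auto
  qed
  have g_col: "g {b k, y'} = (if k = i then \<beta> else 0)" if "k < n" for k
  proof (cases "k = i")
    case False
    have "f {b k, y'} = 0" using support[of "{b k, y'}"] new by auto
    moreover have "{b k, y'} \<notin> {c, u}" "{b k, y'} \<noteq> {x', y'}"
      unfolding cu using bV[OF that] new xyV False b_eq[OF that] neq by (auto simp: doubleton_eq_iff)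
    ultimately show ?thesis using False unfolding g by auto
  qed (simp add: \<beta>_def xy)
  have g_row: "g {x', w k} = (if k = j then \<alpha> else 0)" if "k < n" for k
  proof (cases "k = j")
    case False
    have "f {x', w k} = 0" using support[of "{x', w k}"] new by auto
    moreover have "{x', w k} \<notin> {c, u}" "{x', w k} \<noteq> {x', y'}"
      unfolding cu using wV[OF that] new xyV False w_eq[OF that] neq by (auto simp: doubleton_eq_iff)
    ultimately show ?thesis using False unfolding g by auto
  qed (simp add: \<alpha>_def xy)
  have g_corner: "g {x', y'} = - 1" unfolding g by simp
  have M: "edge_matrix g (Suc n) b' w' = bordered (edge_matrix f n b w) n i j \<alpha> \<beta>"
    by (intro eq_matI)
       (auto simp: edge_matrix_def bordered_def b'_def w'_def g_old g_col g_row g_corner less_Suc_eq)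
  have A: "edge_matrix f n b w \<in> carrier_mat n n" by (simp add: edge_matrix_def)
  have distinct: "{x', y} \<noteq> {x, y'}" "{x', y} \<noteq> {x', y'}" "{x, y'} \<noteq> {x', y'}"
    using neq by (auto simp: doubleton_eq_iff)
  have entries: "(\<alpha> = t \<and> \<beta> = - 1 \<and> u = {x, y'}) \<or> (\<alpha> = - 1 \<and> \<beta> = t \<and> u = {x', y})"
    using sides
  proof
    assume "(c, u) = ({x', y}, {x, y'})"
    then have "c = {x', y}" "u = {x, y'}" by simp_all
    then show ?thesis
      using distinct by (simp only: \<alpha>_def \<beta>_def g fun_upd_apply distinct[symmetric]) simp
  next
    assume "(c, u) = ({x, y'}, {x', y})"
    then have "c = {x, y'}" "u = {x', y}" by simp_all
    then show ?thesis
      using distinct by (simp only: \<alpha>_def \<beta>_def g fun_upd_apply distinct[symmetric]) simp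
  qed
  then have prod: "\<alpha> * \<beta> = - t" by auto
  have det: "det (edge_matrix g (Suc n) b' w') = t * Q - P"
    unfolding M det_bordered[OF A ij(1,2)] P Q prod by simp
  show "det_and_cofactor g V' {x', y'} (t * Q - P) P"
  proof (rule det_and_cofactorI[OF b' w', of n n])
    show "{x', y'} = {b' n, w' n}" by (simp add: b'_def w'_def)
    show "cofactor (edge_matrix g (Suc n) b' w') n n = P"
      by (simp only: M cofactor_bordered_corner[OF A] P)
  qed (auto intro: det)
  show "det_and_cofactor g V' u (t * Q - P) (- t * Q)"
    using entries
  proof (elim disjE conjE)
    assume "\<beta> = t" and u: "u = {x', y}"
    then have "cofactor (edge_matrix g (Suc n) b' w') n j = - t * Q"
      by (simp only: M cofactor_bordered_row[OF A ij(1,2)] Q)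
    moreover have "u = {b' n, w' j}" using u ij xy by (simp add: b'_def w'_def)
    ultimately show ?thesis
      using ij det by (intro det_and_cofactorI[OF b' w', of n j]) auto
  next
    assume "\<alpha> = t" and u: "u = {x, y'}"
    then have "cofactor (edge_matrix g (Suc n) b' w') i n = - t * Q"
      by (simp only: M cofactor_bordered_col[OF A ij(1,2)] Q)
    moreover have "u = {b' i, w' n}" using u ij xy by (simp add: b'_def w'_def)
    ultimately show ?thesis
      using ij det by (intro det_and_cofactorI[OF b' w', of i n]) auto
  qed
qed

text \<open>The same step without reference to colors: \<open>v\<close>, \<open>v'\<close> are the ends of the glued edge in either order of
colors, joined to the new vertices \<open>z\<close>, \<open>z'\<close> by the colored and the uncolored side edge.\<close>

lemma det_and_cofactor_attach_edges:
  fixes f :: "edge \<Rightarrow> 'a :: idom"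
  assumes old: "det_and_cofactor f V {v, v'} P Q"
    and support: "\<And>e. f e \<noteq> 0 \<Longrightarrow> e \<subseteq> V"
    and parity: "even (fst v + snd v) \<longleftrightarrow> odd (fst v' + snd v')"
      "even (fst z + snd z) \<longleftrightarrow> odd (fst v + snd v)" "even (fst z' + snd z') \<longleftrightarrow> odd (fst v' + snd v')"
    and new: "z \<notin> V" "z' \<notin> V"
    and g: "g = f({v, z} := t, {v', z'} := - 1, {z, z'} := - 1)" and V': "V' = V \<union> {z, z'}"
  shows "det_and_cofactor g V' {z, z'} (t * Q - P) P"
    and "det_and_cofactor g V' {v', z'} (t * Q - P) (- t * Q)"
proof -
  have "det_and_cofactor g V' {z, z'} (t * Q - P) P \<and>
      det_and_cofactor g V' {v', z'} (t * Q - P) (- t * Q)"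
  proof (cases "even (fst v + snd v)")
    case True
    have flip: "{v', z'} = {z', v'}" "{z, z'} = {z', z}" by (rule insert_commute)+
    have "even (fst v + snd v)" "odd (fst v' + snd v')" "even (fst z' + snd z')" "odd (fst z + snd z)"
      using True parity by auto
    note this new(2,1)
    moreover have "({v, z}, {z', v'}) = ({z', v'}, {v, z}) \<or> ({v, z}, {z', v'}) = ({v, z}, {z', v'})"
      by (rule disjI2) (rule refl)
    moreover have "V' = insert z' (insert z V)" using V' by blast
    ultimately show ?thesis
      using det_and_cofactor_attach_box[OF old support _ _ _ _ _ _ _ g[unfolded flip]]
      unfolding flip by blast
  next
    case False
    have "{v, v'} = {v', v}" by (rule insert_commute)
    note old' = old[unfolded this]
    have "even (fst v' + snd v')" "odd (fst v + snd v)" "even (fst z + snd z)" "odd (fst z' + snd z')"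
      using False parity by auto
    note this new
    moreover have "{v, z} = {z, v}" by (rule insert_commute)
    then have "({v, z}, {v', z'}) = ({z, v}, {v', z'}) \<or> ({v, z}, {v', z'}) = ({v', z'}, {z, v})"
      by simp
    moreover have "V' = insert z (insert z' V)" using V' by blast
    ultimately show ?thesis
      using det_and_cofactor_attach_box[OF old' support _ _ _ _ _ _ _ g] by blast
  qed
  then show "det_and_cofactor g V' {z, z'} (t * Q - P) P"
    and "det_and_cofactor g V' {v', z'} (t * Q - P) (- t * Q)" by blast+
qed

section \<open>Signed edge weights of snake graphs\<close>

text \<open>The weight of the colored edge of a box, in terms of the sign of the edge along which it is glued.\<close>

fun sign_weight :: "sign \<Rightarrow> ratfun" where
  "sign_weight Minus = q_var"
| "sign_weight Plus = inverse q_var"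

text \<open>Uncolored edges are oriented from white to black and hence enter the matrix as \<open>- 1\<close>.\<close>

definition signed_weight :: "snake \<Rightarrow> edge \<Rightarrow> ratfun" where
  "signed_weight G e = (if e \<in> blue G then q_var else if e \<in> red G then inverse q_var
     else if e \<in> edges G then - 1 else 0)"

lemma colored_subset_edges: "blue G \<subseteq> edges G" "red G \<subseteq> edges G"
proof -
  have "western_border G \<subseteq> edges G" "southern_border G \<subseteq> edges G"
    unfolding western_border_def southern_border_def edges_def box_edges_def by blast+
  then show "blue G \<subseteq> edges G" "red G \<subseteq> edges G"
    unfolding blue_def red_def by blast+
qed

lemma signed_weight_support: "signed_weight G e \<noteq> 0 \<Longrightarrow> e \<subseteq> vertices G"
  using colored_subset_edges[of G] by (auto simp: signed_weight_def vertices_def split: if_splits)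

lemma kasteleyn_matrix_eq_edge_matrix:
  assumes "bij_betw b {..<l} (black G)" "bij_betw w {..<l} (white G)"
  shows "kasteleyn_matrix G l b w = edge_matrix (signed_weight G) l b w"
proof -
  have "(if (b i, w j) \<in> oriented_edges G then weight G {b i, w j}
     else if (w j, b i) \<in> oriented_edges G then - weight G {b i, w j} else 0) = signed_weight G {b i, w j}"
    if "i < l" "j < l" for i j
  proof -
    have bw: "b i \<in> black G" "w j \<in> white G" using assms that by (auto simp: bij_betw_def)
    then have "b i \<notin> white G" "w j \<notin> black G" by (auto simp: black_def white_def)
    then have "(b i, w j) \<in> oriented_edges G \<longleftrightarrow> {b i, w j} \<in> colored G"
      "(w j, b i) \<in> oriented_edges G \<longleftrightarrow> {b i, w j} \<in> edges G - colored G"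
      using bw by (auto simp: oriented_edges_def insert_commute)
    then show ?thesis
      by (auto simp: weight_def signed_weight_def colored_def)
  qed
  then show ?thesis
    unfolding kasteleyn_matrix_def edge_matrix_def by (intro eq_matI) auto
qed

lemma is_snake_snoc:
  assumes "G \<noteq> []"
  shows "is_snake (G @ [B]) \<longleftrightarrow> is_snake G \<and> (B = move_right (last G) \<or> B = move_up (last G))"
proof -
  let ?P = "\<lambda>H t. H ! Suc t = move_right (H ! t) \<or> H ! Suc t = move_up (H ! t)"
  obtain n where n: "length G = Suc n" using assms by (cases G) auto
  have "(\<forall>t. Suc t < Suc (Suc n) \<longrightarrow> X t) \<longleftrightarrow> (\<forall>t<n. X t) \<and> X n" for X
    by (metis Suc_less_eq less_Suc_eq)
  then have "(\<forall>t. Suc t < length (G @ [B]) \<longrightarrow> ?P (G @ [B]) t) \<longleftrightarrow>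
      (\<forall>t<n. ?P (G @ [B]) t) \<and> ?P (G @ [B]) n"
    by (simp only: length_append n list.size add_Suc_right add_0_right)
  also have "(\<forall>t<n. ?P (G @ [B]) t) \<longleftrightarrow> (\<forall>t. Suc t < length G \<longrightarrow> ?P G t)"
    using n by (auto simp: nth_append)
  also have "?P (G @ [B]) n \<longleftrightarrow> B = move_right (last G) \<or> B = move_up (last G)"
    using n assms by (auto simp: nth_append last_conv_nth)
  finally have steps: "(\<forall>t. Suc t < length (G @ [B]) \<longrightarrow> ?P (G @ [B]) t) \<longleftrightarrow>
      (\<forall>t. Suc t < length G \<longrightarrow> ?P G t) \<and> (B = move_right (last G) \<or> B = move_up (last G))" .
  show ?thesis
    unfolding is_snake_def steps hd_append2[OF assms]
    using assms by (simp only: append_is_Nil_conv list.simps simp_thms conj_assoc)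
qed

text \<open>Boxes only move right and up, so the last box bounds all others. This is what makes the vertices of
a newly glued box new.\<close>

lemma snake_range:
  assumes "is_snake G" "(x, y) \<in> set G" "last G = (x0, y0)"
  shows "0 \<le> x \<and> x \<le> x0 \<and> 0 \<le> y \<and> y \<le> y0"
proof -
  have "G \<noteq> []" using assms(1) by (simp add: is_snake_def)
  then show ?thesis
    using assms
  proof (induction G arbitrary: x y x0 y0 rule: rev_nonempty_induct)
    case (single B)
    then show ?case by (auto simp: is_snake_def)
  next
    case (snoc B G)
    obtain x1 y1 where L: "last G = (x1, y1)" by fastforce
    then have "(x1, y1) \<in> set G" using last_in_set[OF snoc.hyps(1)] by simp
    moreover have "is_snake G" "(x0, y0) = (x1 + 1, y1) \<or> (x0, y0) = (x1, y1 + 1)"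
      using snoc.prems is_snake_snoc[OF snoc.hyps(1)] L by auto
    ultimately show ?case
      using snoc.IH[OF _ _ L, of x1 y1] snoc.IH[OF _ _ L, of x y] snoc.prems by auto
  qed
qed

lemma snake_vertices_range:
  assumes "is_snake G" "(x, y) \<in> vertices G" "last G = (x0, y0)"
  shows "x \<le> x0 + 1 \<and> y \<le> y0 + 1"
proof -
  obtain a b where "(a, b) \<in> set G" "(x, y) \<in> \<Union> (box_edges (a, b))"
    using assms(2) unfolding vertices_def edges_def by fastforce
  then show ?thesis
    using snake_range[OF assms(1) _ assms(3), of a b]
    by (auto simp: box_edges_def south_def north_def west_def east_def)
qed

text \<open>Boxes without a left neighbour in the snake; their west edges form the western border. The
counting in \<open>in_one_box\<close> thereby becomes a membership condition that is easy to follow under gluing.\<close>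

definition west_free :: "vertex set \<Rightarrow> vertex set" where
  "west_free S = {(x, y). (x, y) \<in> S \<and> (x - 1, y) \<notin> S}"

definition south_free :: "vertex set \<Rightarrow> vertex set" where
  "south_free S = {(x, y). (x, y) \<in> S \<and> (x, y - 1) \<notin> S}"

lemma vedge_eq_iff: "vedge A = vedge B \<longleftrightarrow> A = B"
  by (cases A; cases B) (auto simp: doubleton_eq_iff)

lemma hedge_eq_iff: "hedge A = hedge B \<longleftrightarrow> A = B"
  by (cases A; cases B) (auto simp: doubleton_eq_iff)

lemma vedge_neq_hedge: "vedge A \<noteq> hedge B"
  by (cases A; cases B) (auto simp: doubleton_eq_iff)

lemmas edge_eq_simps = vedge_eq_iff hedge_eq_iff vedge_neq_hedge vedge_neq_hedge[symmetric]

text \<open>Every edge \<open>e\<close> of the grid belongs to exactly two boxes \<open>B\<close> and \<open>C\<close> of the grid, so only the presence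
of the other one has to be checked.\<close>

lemma in_one_box_iff:
  assumes "B \<in> set G" "C \<noteq> B" "\<And>D. e \<in> box_edges D \<longleftrightarrow> D = B \<or> D = C"
  shows "in_one_box G e \<longleftrightarrow> C \<notin> set G"
proof -
  have "{D \<in> set G. e \<in> box_edges D} = (if C \<in> set G then {B, C} else {B})"
    using assms by auto
  then show ?thesis using assms(2) unfolding in_one_box_def by auto
qed

lemma western_border_eq: "western_border G = vedge ` west_free (set G)"
proof -
  have "in_one_box G (vedge (x, y)) \<longleftrightarrow> (x - 1, y) \<notin> set G" if "(x, y) \<in> set G" for x y
    using that by (intro in_one_box_iff[of "(x, y)"])
      (auto simp: box_edges_def south_def north_def west_def east_def edge_eq_simps
        simp del: vedge.simps hedge.simps)
  then show ?thesis
    unfolding western_border_def west_free_def west_def by (auto simp del: vedge.simps)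
qed

lemma southern_border_eq: "southern_border G = hedge ` south_free (set G)"
proof -
  have "in_one_box G (hedge (x, y)) \<longleftrightarrow> (x, y - 1) \<notin> set G" if "(x, y) \<in> set G" for x y
    using that by (intro in_one_box_iff[of "(x, y)"])
      (auto simp: box_edges_def south_def north_def west_def east_def edge_eq_simps
        simp del: vedge.simps hedge.simps)
  then show ?thesis
    unfolding southern_border_def south_free_def south_def by (auto simp del: hedge.simps)
qed

lemma image_pairs: "{f (x, y) | x y. P x y} = f ` {(x, y). P x y}"
  by auto

lemma inj_vedge: "inj vedge" and inj_hedge: "inj hedge"
  by (simp_all add: inj_def edge_eq_simps del: vedge.simps hedge.simps)

lemma blue_eq: "blue G = vedge ` {(x, y). (x, y) \<in> west_free (set G) \<and> even (x + y)} \<union>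
    hedge ` {(x, y). (x, y) \<in> south_free (set G) \<and> x \<ge> 1 \<and> odd (x + y)}"
  unfolding blue_def western_border_eq southern_border_eq
    inj_image_mem_iff[OF inj_vedge] inj_image_mem_iff[OF inj_hedge] image_pairs[of vedge] image_pairs[of hedge] ..

lemma red_eq: "red G = vedge ` {(x, y). (x, y) \<in> west_free (set G) \<and> odd (x + y)} \<union>
    hedge ` {(x, y). (x, y) \<in> south_free (set G) \<and> x \<ge> 1 \<and> even (x + y)}"
  unfolding red_def western_border_eq southern_border_eq
    inj_image_mem_iff[OF inj_vedge] inj_image_mem_iff[OF inj_hedge] image_pairs[of vedge] image_pairs[of hedge] ..

lemma signed_weight_update:
  assumes "blue G' = blue G \<union> (if s = Minus then {c} else {})"
    and "red G' = red G \<union> (if s = Minus then {} else {c})"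
    and "edges G' = edges G \<union> {c, u, e}" "c \<notin> edges G" "u \<notin> edges G" "e \<notin> edges G"
    and "c \<noteq> u" "c \<noteq> e"
  shows "signed_weight G' = (signed_weight G)(c := sign_weight s, u := - 1, e := - 1)"
proof
  have "c \<notin> blue G" "u \<notin> blue G" "e \<notin> blue G" "c \<notin> red G" "u \<notin> red G" "e \<notin> red G"
    using assms(4-6) colored_subset_edges[of G] by blast+
  then show "signed_weight G' d = ((signed_weight G)(c := sign_weight s, u := - 1, e := - 1)) d" for d
    using assms(7,8) by (cases s) (simp_all add: signed_weight_def assms(1-3))
qed

text \<open>A box glued at the right contributes its south edge to the southern border, and this edge has
\<open>x \<ge> 1\<close>, so it is colored. Its west edge is the glued one, and no edge of the previous boxes leaves
the border, since the glued edge was on the eastern one.\<close>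

lemma signed_weight_move_right:
  assumes "is_snake G" "last G = (x, y)"
  shows "signed_weight (G @ [(x + 1, y)]) = (signed_weight G)
      ({(x + 1, y), (x + 2, y)} := sign_weight (if even (x + y) then Minus else Plus),
       {(x + 1, y + 1), (x + 2, y + 1)} := - 1, {(x + 2, y), (x + 2, y + 1)} := - 1)"
    and "vertices (G @ [(x + 1, y)]) = vertices G \<union> {(x + 2, y), (x + 2, y + 1)}"
proof -
  let ?B = "(x + 1, y)"
  have L: "(x, y) \<in> set G" using assms by (metis is_snake_def last_in_set)
  note range = snake_range[OF assms(1) _ assms(2)]
  have x: "x \<ge> 0" using range[OF L] by simp
  have west: "west_free (set (G @ [?B])) = west_free (set G)"
    using L range by (fastforce simp: west_free_def)
  have south: "south_free (set (G @ [?B])) = insert ?B (south_free (set G))"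
    using L range by (fastforce simp: south_free_def)
  have shared: "west ?B = east (x, y)" and old_edge: "east (x, y) \<in> edges G"
    using L unfolding edges_def box_edges_def by (simp add: west_def east_def, blast)
  have "edges (G @ [?B]) = edges G \<union> box_edges ?B"
    by (simp add: edges_def Un_commute)
  then have E: "edges (G @ [?B]) = edges G \<union> {south ?B, north ?B, east ?B}"
    using old_edge unfolding box_edges_def shared by blast
  have sides: "south ?B = {(x + 1, y), (x + 2, y)}" "north ?B = {(x + 1, y + 1), (x + 2, y + 1)}"
    "east ?B = {(x + 2, y), (x + 2, y + 1)}"
    by (simp_all add: south_def north_def west_def east_def ac_simps)
  have "\<not> {(x + 2, y'), p} \<subseteq> vertices G" for y' p
    using snake_vertices_range[OF assms(1) _ assms(2), of "x + 2" y'] by auto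
  then have new: "e \<notin> edges G" if "(x + 2, y') \<in> e" for e y'
    using that unfolding vertices_def by blast
  have box: "hedge ?B = {(x + 1, y), (x + 2, y)}"
    by (simp add: ac_simps)
  show "signed_weight (G @ [?B]) = (signed_weight G)
      ({(x + 1, y), (x + 2, y)} := sign_weight (if even (x + y) then Minus else Plus),
       {(x + 1, y + 1), (x + 2, y + 1)} := - 1, {(x + 2, y), (x + 2, y + 1)} := - 1)"
  proof (rule signed_weight_update)
    have blue: "{(a, b). (a, b) \<in> insert ?B (south_free (set G)) \<and> a \<ge> 1 \<and> odd (a + b)}
      = {(a, b). (a, b) \<in> south_free (set G) \<and> a \<ge> 1 \<and> odd (a + b)} \<union> (if even (x + y) then {?B} else {})"
      using x by auto
    have "blue (G @ [?B]) = blue G \<union> hedge ` (if even (x + y) then {?B} else {})"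
      unfolding blue_eq west south blue image_Un by (simp only: Un_ac)
    then show "blue (G @ [?B]) = blue G \<union>
        (if (if even (x + y) then Minus else Plus) = Minus then {{(x + 1, y), (x + 2, y)}} else {})"
      by (cases "even (x + y)")
        (simp_all only: if_True if_False image_insert image_empty box sign.distinct simp_thms)
    have red: "{(a, b). (a, b) \<in> insert ?B (south_free (set G)) \<and> a \<ge> 1 \<and> even (a + b)}
      = {(a, b). (a, b) \<in> south_free (set G) \<and> a \<ge> 1 \<and> even (a + b)} \<union> (if even (x + y) then {} else {?B})"
      using x by auto
    have "red (G @ [?B]) = red G \<union> hedge ` (if even (x + y) then {} else {?B})"
      unfolding red_eq west south red image_Un by (simp only: Un_ac)
    then show "red (G @ [?B]) = red G \<union>
        (if (if even (x + y) then Minus else Plus) = Minus then {} else {{(x + 1, y), (x + 2, y)}})"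
      by (cases "even (x + y)")
        (simp_all only: if_True if_False image_insert image_empty box sign.distinct simp_thms)
    show "edges (G @ [?B]) = edges G \<union>
      {{(x + 1, y), (x + 2, y)}, {(x + 1, y + 1), (x + 2, y + 1)}, {(x + 2, y), (x + 2, y + 1)}}"
      unfolding E sides ..
    show "{(x + 1, y), (x + 2, y)} \<notin> edges G" "{(x + 1, y + 1), (x + 2, y + 1)} \<notin> edges G"
      "{(x + 2, y), (x + 2, y + 1)} \<notin> edges G"
      using new by blast+
  qed (simp_all add: doubleton_eq_iff)
  have "east (x, y) \<subseteq> vertices G"
    using old_edge unfolding vertices_def by blast
  then have "{(x + 1, y), (x + 1, y + 1)} \<subseteq> vertices G"
    by (simp add: east_def)
  then show "vertices (G @ [?B]) = vertices G \<union> {(x + 2, y), (x + 2, y + 1)}"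
    unfolding vertices_def E Union_Un_distrib sides by blast
qed

text \<open>The mirror image of the previous step: the new colored edge is the west edge. The parity that makes it
blue is the opposite one, since vertical and horizontal border edges follow opposite conventions.\<close>

lemma signed_weight_move_up:
  assumes "is_snake G" "last G = (x, y)"
  shows "signed_weight (G @ [(x, y + 1)]) = (signed_weight G)
      ({(x, y + 1), (x, y + 2)} := sign_weight (if even (x + y) then Plus else Minus),
       {(x + 1, y + 1), (x + 1, y + 2)} := - 1, {(x, y + 2), (x + 1, y + 2)} := - 1)"
    and "vertices (G @ [(x, y + 1)]) = vertices G \<union> {(x, y + 2), (x + 1, y + 2)}"
proof -
  let ?B = "(x, y + 1)"
  have L: "(x, y) \<in> set G" using assms by (metis is_snake_def last_in_set)
  note range = snake_range[OF assms(1) _ assms(2)]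
  have west: "west_free (set (G @ [?B])) = insert ?B (west_free (set G))"
    using L range by (fastforce simp: west_free_def)
  have south: "south_free (set (G @ [?B])) = south_free (set G)"
    using L range by (fastforce simp: south_free_def)
  have shared: "south ?B = north (x, y)" and old_edge: "north (x, y) \<in> edges G"
    using L unfolding edges_def box_edges_def by (simp add: south_def north_def, blast)
  have "edges (G @ [?B]) = edges G \<union> box_edges ?B"
    by (simp add: edges_def Un_commute)
  then have E: "edges (G @ [?B]) = edges G \<union> {west ?B, east ?B, north ?B}"
    using old_edge unfolding box_edges_def shared by blast
  have sides: "west ?B = {(x, y + 1), (x, y + 2)}" "east ?B = {(x + 1, y + 1), (x + 1, y + 2)}"
    "north ?B = {(x, y + 2), (x + 1, y + 2)}"
    by (simp_all add: south_def north_def west_def east_def ac_simps)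
  have "\<not> {(x', y + 2), p} \<subseteq> vertices G" for x' p
    using snake_vertices_range[OF assms(1) _ assms(2), of x' "y + 2"] by auto
  then have new: "e \<notin> edges G" if "(x', y + 2) \<in> e" for e x'
    using that unfolding vertices_def by blast
  have box: "vedge ?B = {(x, y + 1), (x, y + 2)}"
    by (simp add: ac_simps)
  show "signed_weight (G @ [?B]) = (signed_weight G)
      ({(x, y + 1), (x, y + 2)} := sign_weight (if even (x + y) then Plus else Minus),
       {(x + 1, y + 1), (x + 1, y + 2)} := - 1, {(x, y + 2), (x + 1, y + 2)} := - 1)"
  proof (rule signed_weight_update)
    have blue: "{(a, b). (a, b) \<in> insert ?B (west_free (set G)) \<and> even (a + b)}
      = {(a, b). (a, b) \<in> west_free (set G) \<and> even (a + b)} \<union> (if even (x + y) then {} else {?B})"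
      by auto
    have "blue (G @ [?B]) = blue G \<union> vedge ` (if even (x + y) then {} else {?B})"
      unfolding blue_eq west south blue image_Un by (simp only: Un_ac)
    then show "blue (G @ [?B]) = blue G \<union>
        (if (if even (x + y) then Plus else Minus) = Minus then {{(x, y + 1), (x, y + 2)}} else {})"
      by (cases "even (x + y)")
        (simp_all only: if_True if_False image_insert image_empty box sign.distinct simp_thms)
    have red: "{(a, b). (a, b) \<in> insert ?B (west_free (set G)) \<and> odd (a + b)}
      = {(a, b). (a, b) \<in> west_free (set G) \<and> odd (a + b)} \<union> (if even (x + y) then {?B} else {})"
      by auto
    have "red (G @ [?B]) = red G \<union> vedge ` (if even (x + y) then {?B} else {})"
      unfolding red_eq west south red image_Un by (simp only: Un_ac)
    then show "red (G @ [?B]) = red G \<union>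
        (if (if even (x + y) then Plus else Minus) = Minus then {} else {{(x, y + 1), (x, y + 2)}})"
      by (cases "even (x + y)")
        (simp_all only: if_True if_False image_insert image_empty box sign.distinct simp_thms)
    show "edges (G @ [?B]) = edges G \<union>
      {{(x, y + 1), (x, y + 2)}, {(x + 1, y + 1), (x + 1, y + 2)}, {(x, y + 2), (x + 1, y + 2)}}"
      unfolding E sides ..
    show "{(x, y + 1), (x, y + 2)} \<notin> edges G" "{(x + 1, y + 1), (x + 1, y + 2)} \<notin> edges G"
      "{(x, y + 2), (x + 1, y + 2)} \<notin> edges G"
      using new by blast+
  qed (simp_all add: doubleton_eq_iff)
  have "north (x, y) \<subseteq> vertices G"
    using old_edge unfolding vertices_def by blast
  then have "{(x, y + 1), (x + 1, y + 1)} \<subseteq> vertices G"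
    by (simp add: north_def)
  then show "vertices (G @ [?B]) = vertices G \<union> {(x, y + 2), (x + 1, y + 2)}"
    unfolding vertices_def E Union_Un_distrib sides by blast
qed

lemma is_sign_labelling_snoc:
  assumes "G \<noteq> []" "is_sign_labelling (G @ [B]) \<sigma>"
  shows "is_sign_labelling G \<sigma>"
  using assms unfolding is_sign_labelling_def by auto

lemma opp_iff: "s \<noteq> s' \<longleftrightarrow> s = opp s'"
  by (cases s; cases s') auto

text \<open>A shared edge is east or north in one box and west or south in the next one. As north goes with west
and south with east, the signs of east and north edges swap at every step, that is with the parity of
\<open>x + y\<close>. This ties the labelling to the parity that decides between blue and red.\<close>

lemma sign_east_last:
  assumes "is_snake G" "is_sign_labelling G \<sigma>" "last G = (x, y)"
  shows "\<sigma> (east (x, y)) = (if even (x + y) then Minus else Plus)"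
    and "\<sigma> (north (x, y)) = (if even (x + y) then Plus else Minus)"
proof -
  have G: "G \<noteq> []" using assms(1) by (simp add: is_snake_def)
  have "\<sigma> (east (x, y)) = (if even (x + y) then Minus else Plus) \<and>
      \<sigma> (north (x, y)) = (if even (x + y) then Plus else Minus)"
    using G assms
  proof (induction G arbitrary: x y rule: rev_nonempty_induct)
    case (single B)
    then show ?case by (auto simp: is_snake_def is_sign_labelling_def)
  next
    case (snoc B G)
    obtain x1 y1 where L: "last G = (x1, y1)" by fastforce
    have B: "B = (x, y)" using snoc.prems by simp
    have step: "is_snake G" "(x, y) = (x1 + 1, y1) \<or> (x, y) = (x1, y1 + 1)"
      using snoc.prems is_snake_snoc[OF snoc.hyps(1)] L by auto
    have box: "\<sigma> (north B) = \<sigma> (west B)" "\<sigma> (south B) = \<sigma> (east B)" "\<sigma> (north B) \<noteq> \<sigma> (south B)"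
      using snoc.prems(2) by (auto simp: is_sign_labelling_def)
    have IH: "\<sigma> (east (x1, y1)) = (if even (x1 + y1) then Minus else Plus)"
      "\<sigma> (north (x1, y1)) = (if even (x1 + y1) then Plus else Minus)"
      using snoc.IH[OF step(1) is_sign_labelling_snoc[OF snoc.hyps(1) snoc.prems(2)] L] by auto
    from step(2) show ?case
    proof
      assume eq: "(x, y) = (x1 + 1, y1)"
      then have "west B = east (x1, y1)" unfolding B by (simp add: west_def east_def)
      then have "\<sigma> (north B) = \<sigma> (east (x1, y1))" "\<sigma> (east B) = opp (\<sigma> (north B))"
        using box opp_iff by metis+
      then show ?thesis using IH eq unfolding B by simp
    next
      assume eq: "(x, y) = (x1, y1 + 1)"
      then have "south B = north (x1, y1)" unfolding B by (simp add: south_def north_def)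
      then have "\<sigma> (east B) = \<sigma> (north (x1, y1))" "\<sigma> (north B) = opp (\<sigma> (east B))"
        using box opp_iff by metis+
      then show ?thesis using IH eq unfolding B by simp
    qed
  qed
  then show "\<sigma> (east (x, y)) = (if even (x + y) then Minus else Plus)"
    and "\<sigma> (north (x, y)) = (if even (x + y) then Plus else Minus)" by auto
qed

section \<open>The determinant of a snake graph from its sign sequence\<close>

text \<open>The uncolored side edge of the new box \<open>B\<close> is its north edge if \<open>B\<close> is glued at the right and its east
edge if \<open>B\<close> is glued on the top. In both cases the labelling rules give it the sign of the glued edge,
and the opposite edge the other sign. So the sign alone tells how the snake continues.\<close>

lemma det_and_cofactor_add_box:
  assumes "is_snake (G @ [B])" "is_sign_labelling (G @ [B]) \<sigma>" "G \<noteq> []"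
    and e: "e = shared_edge (last G) B"
    and old: "det_and_cofactor (signed_weight G) (vertices G) e P Q"
    and e': "e' \<in> {north B, east B}" and t: "t = sign_weight (\<sigma> e)"
  shows "det_and_cofactor (signed_weight (G @ [B])) (vertices (G @ [B])) e'
    (t * Q - P) (if \<sigma> e' = \<sigma> e then - t * Q else P)"
proof -
  obtain x y where L: "last G = (x, y)" by fastforce
  have G: "is_snake G" and B: "B = (x + 1, y) \<or> B = (x, y + 1)"
    using assms(1) is_snake_snoc[OF assms(3)] L by auto
  note \<sigma> = sign_east_last[OF G is_sign_labelling_snoc[OF assms(3,2)] L]
  have box: "\<sigma> (north B) = \<sigma> (west B)" "\<sigma> (south B) = \<sigma> (east B)" "\<sigma> (north B) \<noteq> \<sigma> (south B)"
    using assms(2) by (auto simp: is_sign_labelling_def)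
  note range = snake_vertices_range[OF G _ L]
  from B show ?thesis
  proof
    assume B: "B = (x + 1, y)"
    have e_east: "e = east (x, y)" using e L B by (simp add: shared_edge_def)
    then have same: "\<sigma> (north B) = \<sigma> e" "\<sigma> (east B) \<noteq> \<sigma> e"
      using box by (auto simp: B west_def east_def)
    have "det_and_cofactor (signed_weight G) (vertices G) {(x + 1, y), (x + 1, y + 1)} P Q"
      using old by (simp add: e_east east_def)
    note old_edge = this
    have new: "(x + 2, y) \<notin> vertices G" "(x + 2, y + 1) \<notin> vertices G"
      using range[of "x + 2"] by force+
    have weights: "signed_weight (G @ [B]) = (signed_weight G)
        ({(x + 1, y), (x + 2, y)} := t, {(x + 1, y + 1), (x + 2, y + 1)} := - 1, {(x + 2, y), (x + 2, y + 1)} := - 1)"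
      unfolding B t e_east \<sigma> by (rule signed_weight_move_right[OF G L])
    have verts: "vertices (G @ [B]) = vertices G \<union> {(x + 2, y), (x + 2, y + 1)}"
      unfolding B by (rule signed_weight_move_right[OF G L])
    note step = det_and_cofactor_attach_edges[OF old_edge signed_weight_support _ _ _ new weights verts]
    have "det_and_cofactor (signed_weight (G @ [B])) (vertices (G @ [B])) {(x + 2, y), (x + 2, y + 1)}
        (t * Q - P) P \<and>
      det_and_cofactor (signed_weight (G @ [B])) (vertices (G @ [B])) {(x + 1, y + 1), (x + 2, y + 1)}
        (t * Q - P) (- t * Q)"
      by (intro conjI step) auto
    moreover have "north B = {(x + 1, y + 1), (x + 2, y + 1)}" "east B = {(x + 2, y), (x + 2, y + 1)}"
      by (simp_all add: B north_def east_def ac_simps)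
    ultimately show ?thesis
      using e' same by auto
  next
    assume B: "B = (x, y + 1)"
    have e_north: "e = north (x, y)" using e L B by (simp add: shared_edge_def)
    then have same: "\<sigma> (east B) = \<sigma> e" "\<sigma> (north B) \<noteq> \<sigma> e"
      using box by (auto simp: B south_def north_def)
    have "det_and_cofactor (signed_weight G) (vertices G) {(x, y + 1), (x + 1, y + 1)} P Q"
      using old by (simp add: e_north north_def)
    note old_edge = this
    have new: "(x, y + 2) \<notin> vertices G" "(x + 1, y + 2) \<notin> vertices G"
      using range[of _ "y + 2"] by force+
    have weights: "signed_weight (G @ [B]) = (signed_weight G)
        ({(x, y + 1), (x, y + 2)} := t, {(x + 1, y + 1), (x + 1, y + 2)} := - 1, {(x, y + 2), (x + 1, y + 2)} := - 1)"
      unfolding B t e_north \<sigma> by (rule signed_weight_move_up[OF G L])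
    have verts: "vertices (G @ [B]) = vertices G \<union> {(x, y + 2), (x + 1, y + 2)}"
      unfolding B by (rule signed_weight_move_up[OF G L])
    note step = det_and_cofactor_attach_edges[OF old_edge signed_weight_support _ _ _ new weights verts]
    have "det_and_cofactor (signed_weight (G @ [B])) (vertices (G @ [B])) {(x, y + 2), (x + 1, y + 2)}
        (t * Q - P) P \<and>
      det_and_cofactor (signed_weight (G @ [B])) (vertices (G @ [B])) {(x + 1, y + 1), (x + 1, y + 2)}
        (t * Q - P) (- t * Q)"
      by (intro conjI step) auto
    moreover have "north B = {(x, y + 2), (x + 1, y + 2)}" "east B = {(x + 1, y + 1), (x + 1, y + 2)}"
      by (simp_all add: B north_def east_def ac_simps)
    ultimately show ?thesis
      using e' same by auto
  qed
qed

text \<open>The single box is itself the result of gluing a box on the top of a graph that has its south edge as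
its only edge; the west edge is the colored one, in accordance with the sign \<open>-\<close> of the south edge.\<close>

lemma det_and_cofactor_single_box:
  assumes "is_sign_labelling [(0, 0)] \<sigma>" "e \<in> {north (0, 0), east (0, 0)}"
  shows "det_and_cofactor (signed_weight [(0, 0)]) (vertices [(0, 0)]) e
    (q_var + 1) (if \<sigma> e = Minus then - q_var else - 1)"
proof -
  define f :: "edge \<Rightarrow> ratfun" where "f = (\<lambda>_. 0)({(0, 0), (1, 0)} := - 1)"
  let ?A = "edge_matrix f 1 (\<lambda>_. (0, 0)) (\<lambda>_. (1, 0))"
  have "even_points {(0, 0), (1, 0)} = {(0, 0)}" "odd_points {(0, 0), (1, 0)} = {(1, 0)}" by auto
  then have bij: "bij_betw (\<lambda>_. (0, 0)) {..<1::nat} (even_points {(0, 0), (1, 0)})"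
    "bij_betw (\<lambda>_. (1, 0)) {..<1::nat} (odd_points {(0, 0), (1, 0)})"
    by (simp_all add: bij_betw_def lessThan_Suc)
  have "det ?A = - 1"
    by (subst det_single) (simp_all add: edge_matrix_def f_def)
  moreover have "cofactor ?A 0 0 = 1"
    by (simp add: cofactor_def mat_delete_def edge_matrix_def)
  ultimately have start: "det_and_cofactor f {(0, 0), (1, 0)} {(0, 0), (1, 0)} (- 1) 1"
    by (intro det_and_cofactorI[OF bij, of 0 0]) simp_all
  have support: "d \<subseteq> {(0, 0), (1, 0)}" if "f d \<noteq> 0" for d
    using that unfolding f_def fun_upd_apply by (metis order_refl)
  have E: "edges [(0, 0)] = {{(0, 0), (1, 0)}, {(0, 1), (1, 1)}, {(0, 0), (0, 1)}, {(1, 0), (1, 1)}}"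
    by (simp add: edges_def box_edges_def south_def north_def west_def east_def)
  have free: "west_free (set [(0, 0)]) = {(0, 0)}" "south_free (set [(0, 0)]) = {(0, 0)}"
    by (auto simp: west_free_def south_free_def)
  have parts: "{(x, y). (x, y) \<in> {(0, 0)} \<and> even (x + y)} = {(0 :: int, 0 :: int)}"
    "{(x, y). (x, y) \<in> {(0, 0)} \<and> odd (x + y)} = ({} :: vertex set)"
    "{(x, y). (x, y) \<in> {(0, 0)} \<and> 1 \<le> x \<and> odd (x + y)} = ({} :: vertex set)"
    "{(x, y). (x, y) \<in> {(0, 0)} \<and> 1 \<le> x \<and> even (x + y)} = ({} :: vertex set)"
    by auto
  have colors: "blue [(0, 0)] = {{(0, 0), (0, 1)}}" "red [(0, 0)] = {}"
    unfolding blue_eq red_eq free parts by simp_all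
  have sw: "signed_weight [(0, 0)] =
      f({(0, 0), (0, 1)} := q_var, {(1, 0), (1, 1)} := - 1, {(0, 1), (1, 1)} := - 1)"
  proof
    have "{(0, 0), (0, 1)} \<noteq> {(1, 0 :: int), (1 :: int, 1)}" "{(0, 0), (0, 1)} \<noteq> {(0 :: int, 1 :: int), (1, 1)}"
      by (simp_all add: doubleton_eq_iff)
    then show "signed_weight [(0, 0)] d =
      (f({(0, 0), (0, 1)} := q_var, {(1, 0), (1, 1)} := - 1, {(0, 1), (1, 1)} := - 1)) d" for d
      unfolding signed_weight_def E colors f_def fun_upd_apply insert_iff empty_iff by presburger
  qed
  have V: "vertices [(0, 0)] = {(0, 0), (1, 0)} \<union> {(0, 1), (1, 1)}"
    unfolding vertices_def E by (simp add: insert_commute)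
  have new: "(0, 1) \<notin> {(0, 0), (1, 0 :: int)}" "(1, 1) \<notin> {(0, 0), (1 :: int, 0 :: int)}"
    by simp_all
  note attach = det_and_cofactor_attach_edges[OF start support _ _ _ new sw V]
  have "det_and_cofactor (signed_weight [(0, 0)]) (vertices [(0, 0)]) {(0, 1), (1, 1)}
      (q_var * 1 - (- 1)) (- 1)"
    by (rule attach(1)) simp_all
  moreover have "det_and_cofactor (signed_weight [(0, 0)]) (vertices [(0, 0)]) {(1, 0), (1, 1)}
      (q_var * 1 - (- 1)) (- q_var * 1)"
    by (rule attach(2)) simp_all
  moreover have "\<sigma> (north (0, 0)) = Plus" "\<sigma> (east (0, 0)) = Minus"
    using assms(1) by (simp_all add: is_sign_labelling_def)
  moreover have "north (0, 0) = {(0, 1), (1, 1)}" "east (0, 0) = {(1, 0), (1, 1)}"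
    by (simp_all add: north_def east_def)
  ultimately show ?thesis using assms(2) by auto
qed

text \<open>The step from \<open>(P, Q)\<close> to \<open>(t * Q - P, P)\<close> or \<open>(t * Q - P, - t * Q)\<close> in terms of \<open>p = \<plusminus> P\<close> and
\<open>r = \<mp> Q\<close>. With opposite signs for determinant and cofactor, all terms become positive.\<close>

fun sweep_step :: "sign \<Rightarrow> sign \<Rightarrow> ratfun \<times> ratfun \<Rightarrow> ratfun \<times> ratfun" where
  "sweep_step s s' (p, r) =
     (p + sign_weight s * r, if s' = s then sign_weight s * r else p)"

fun sweep :: "sign \<Rightarrow> ratfun \<times> ratfun \<Rightarrow> sign list \<Rightarrow> ratfun \<times> ratfun" where
  "sweep s z [] = z"
| "sweep s z (s' # ss) = sweep s' (sweep_step s s' z) ss"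

lemma sweep_snoc: "sweep s z (ss @ [s']) = sweep_step (last (s # ss)) s' (sweep s z ss)"
  by (induction ss arbitrary: s z) auto

lemma zip_tl_snoc:
  "G \<noteq> [] \<Longrightarrow> zip (G @ [B]) (tl (G @ [B])) = zip G (tl G) @ [(last G, B)]"
proof (induction G)
  case (Cons A G)
  then show ?case by (cases G) auto
qed simp

lemma sign_sequence_snoc:
  assumes "G \<noteq> []"
  shows "tl (sign_sequence (G @ [B]) \<sigma> e) =
    tl (sign_sequence G \<sigma> (shared_edge (last G) B)) @ [\<sigma> e]"
  using zip_tl_snoc[OF assms] by (simp add: sign_sequence_def)

text \<open>The initial pair \<open>(1, 1)\<close> belongs to the graph whose only edge is the south edge of the first box:
its matrix is \<open>(- 1)\<close>, with cofactor \<open>1\<close>, which explains the exponents of \<open>- 1\<close>.\<close>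

lemma det_and_cofactor_snake:
  assumes "is_snake G" "is_sign_labelling G \<sigma>" "e \<in> {north (last G), east (last G)}"
    and "sweep Minus (1, 1) (tl (sign_sequence G \<sigma> e)) = (p, r)"
  shows "det_and_cofactor (signed_weight G) (vertices G) e
    ((- 1) ^ Suc (length G) * p) ((- 1) ^ length G * r)"
proof -
  have "G \<noteq> []" using assms(1) by (simp add: is_snake_def)
  then show ?thesis
    using assms
  proof (induction G arbitrary: e p r rule: rev_nonempty_induct)
    case (single B)
    then have B: "B = (0, 0)" by (simp add: is_snake_def)
    have "(p, r) = (q_var + 1, if \<sigma> e = Minus then q_var else 1)"
      using single.prems(4) by (cases "\<sigma> e") (auto simp: sign_sequence_def)
    then show ?case
      using det_and_cofactor_single_box[of \<sigma> e] single.prems B by (auto split: if_splits)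
  next
    case (snoc B G)
    let ?e = "shared_edge (last G) B"
    obtain p0 r0 where IHs: "sweep Minus (1, 1) (tl (sign_sequence G \<sigma> ?e)) = (p0, r0)"
      by fastforce
    let ?t = "sign_weight (\<sigma> ?e)"
    have "last (Minus # tl (sign_sequence G \<sigma> ?e)) = \<sigma> ?e"
      by (simp add: sign_sequence_def)
    then have pr: "p = p0 + ?t * r0" "r = (if \<sigma> e = \<sigma> ?e then ?t * r0 else p0)"
      using snoc.prems(4) unfolding sign_sequence_snoc[OF snoc.hyps(1)] sweep_snoc IHs
      by auto
    have G: "is_snake G" using snoc.prems(1) is_snake_snoc[OF snoc.hyps(1)] by auto
    have "?e \<in> {north (last G), east (last G)}" by (simp add: shared_edge_def)
    note IH = snoc.IH[OF G is_sign_labelling_snoc[OF snoc.hyps(1) snoc.prems(2)] this IHs]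
    have "e \<in> {north B, east B}" using snoc.prems(3) by simp
    from det_and_cofactor_add_box[OF snoc.prems(1,2) snoc.hyps(1) refl IH this refl]
    show ?case
      by (auto simp: pr algebra_simps split: if_splits)
  qed
qed

section \<open>From sign blocks to the q-continuant\<close>

lemma sign_weight_opp: "sign_weight (opp s) = inverse (sign_weight s)"
  by (cases s) auto

lemma q_int_Suc: "q_int t (Suc a) = 1 + t * q_int t a"
  unfolding q_int_def by (simp only: sum.lessThan_Suc_shift) (simp add: sum_distrib_left)

lemma sweep_replicate:
  "sweep s (p, r) (replicate n s @ ss) =
   sweep s (p + (q_int (sign_weight s) (Suc n) - 1) * r, sign_weight s ^ n * r) ss"
proof (induction n arbitrary: p r)
  case 0
  show ?case by (simp add: q_int_def)
next
  case (Suc n)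
  have "sweep s (p, r) (replicate (Suc n) s @ ss) =
    sweep s (p + sign_weight s * r, sign_weight s * r) (replicate n s @ ss)"
    by simp
  also have "\<dots> = sweep s (p + (q_int (sign_weight s) (Suc (Suc n)) - 1) * r, sign_weight s ^ Suc n * r) ss"
    unfolding Suc by (simp add: q_int_Suc[of _ "Suc n"] algebra_simps)
  finally show ?case .
qed

text \<open>The outcome of a sweep is linear in the initial pair \<open>(p, r)\<close>, and the coefficients of \<open>p\<close> and \<open>r\<close> are
found block by block. The first sign of the list is the one that the sweep starts from, hence \<open>tl\<close>.
For \<open>p = r = 1\<close> the two denominators cancel and the continuant remains.\<close>

lemma sweep_sign_blocks:
  assumes "a \<ge> 1" "\<forall>b\<in>set as. b \<ge> 1"
  shows "fst (sweep s (p, r) (tl (sign_blocks s (a # as)))) =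
    q_continuant (inverse (sign_weight s)) as * p +
    (q_continuant (sign_weight s) (a # as) - q_continuant (inverse (sign_weight s)) as) * r"
  using assms
proof (induction as arbitrary: a s p r)
  case Nil
  then obtain n where "a = Suc n" by (cases a) auto
  then show ?case using sweep_replicate[of s p r n "[]"] by simp
next
  case (Cons b as)
  let ?w = "sign_weight s"
  obtain n m where a: "a = Suc n" and b: "b = Suc m"
    using Cons.prems by (cases a; cases b) auto
  \<comment> \<open>The pair at the start of the next block is \<open>(?r + ?w ^ a * r, ?r)\<close>.\<close>
  let ?r = "p + (q_int ?w (Suc n) - 1) * r"
  have "opp s \<noteq> s" by (cases s) auto
  then have "sweep s (p, r) (tl (sign_blocks s (a # b # as))) =
    sweep (opp s) (?r + ?w ^ a * r, ?r) (tl (sign_blocks (opp s) (b # as)))"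
    using sweep_replicate[of s p r n "sign_blocks (opp s) (b # as)"]
    by (simp add: a b mult.assoc)
  also have "fst \<dots> = q_continuant ?w as * (?r + ?w ^ a * r) +
      (q_continuant (inverse ?w) (b # as) - q_continuant ?w as) * ?r"
    using Cons.IH[of b "opp s"] Cons.prems by (simp add: sign_weight_opp)
  also have "\<dots> = q_continuant (inverse ?w) (b # as) * p +
      (q_continuant ?w (a # b # as) - q_continuant (inverse ?w) (b # as)) * r"
    by (simp add: a algebra_simps)
  finally show ?case .
qed

theorem corollary5p4:
  fixes x :: rat and R S :: "int poly" and G :: snake
    and l :: nat and b w :: "nat \<Rightarrow> vertex" and F :: ratfun
  assumes "x > 1"
    and "is_q_rational x F"
    and "is_irreducible_fraction F R S"
    and "is_snake_graph_of x G"
    and "bij_betw b {..<l} (black G)"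
    and "bij_betw w {..<l} (white G)"
  shows "\<exists>\<epsilon>\<in>{1, -1}. \<exists>k::int.
           det (kasteleyn_matrix G l b w) = \<epsilon> * (q_var powi k) * to_fract R"
proof -
  obtain as \<sigma> e where snake: "is_snake G" and as: "is_cf_expansion as x"
    and \<sigma>: "is_sign_labelling G \<sigma>" and e: "e \<in> {north (last G), east (last G)}"
    and signs: "sign_sequence G \<sigma> e = sign_blocks Minus as"
    using assms(4) unfolding is_snake_graph_of_def by blast
  obtain a as' where as': "as = a # as'" and pos: "\<forall>c\<in>set as. c \<ge> 1"
    using as unfolding is_cf_expansion_def by (metis neq_Nil_conv)
  let ?N = "q_continuant q_var as" and ?D = "q_continuant (inverse q_var) as'"
  have F: "F = ?N / ?D"
  proof -
    obtain bs where bs: "is_cf_expansion bs x" and "F = q_cf q_var bs"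
      using assms(2) unfolding is_q_rational_def by blast
    moreover have "q_cf q_var bs = q_cf q_var as"
      using as bs q_var_pos unfolding is_cf_expansion_def
      by (intro q_cf_determined_by_value) auto
    ultimately show ?thesis
      using q_cf_eq_quotient[OF q_var_pos, of a as'] pos unfolding as' by simp
  qed
  have unit: "q_unit q_var" by (simp add: q_unit_def)
  have D: "?D \<noteq> 0"
    using q_continuant_pos[of "inverse q_var" as'] q_var_pos pos unfolding as' by auto
  obtain U V where "U \<in> laurent" "V \<in> laurent" "U * ?N + V * ?D = 1"
    using q_continuant_Bezout[OF unit, of a as'] unfolding as' by blast
  moreover have "?N \<in> laurent" "?D \<in> laurent"
    using q_continuant_laurent unit q_unit_inverse by blast+
  moreover have "S \<noteq> 0" "coprime R S" "?N / ?D = to_fract R / to_fract S"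
    using assms(3) F unfolding is_irreducible_fraction_def monic_pos_def by auto
  ultimately obtain \<epsilon> k where N: "\<epsilon> \<in> {1, -1}" "?N = \<epsilon> * q_var powi k * to_fract R"
    using irreducible_numerator_unique[of ?N ?D U V S R] D by blast
  obtain r where sweep: "sweep Minus (1, 1) (tl (sign_sequence G \<sigma> e)) = (?N, r)"
  proof -
    have "fst (sweep Minus (1, 1) (tl (sign_sequence G \<sigma> e))) = ?N"
      using sweep_sign_blocks[of a as' Minus 1 1] pos unfolding signs as' by simp
    then show ?thesis using that by (metis prod.collapse)
  qed
  obtain n b' w' where b': "bij_betw b' {..<n} (black G)" and w': "bij_betw w' {..<n} (white G)"
    and det: "det (edge_matrix (signed_weight G) n b' w') = (- 1) ^ Suc (length G) * ?N"
    using det_and_cofactor_snake[OF snake \<sigma> e sweep]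
    unfolding det_and_cofactor_def black_def white_def by blast
  have "n = l"
    using bij_betw_same_card[OF b'] bij_betw_same_card[OF assms(5)] by simp
  then obtain \<delta> where "\<delta> \<in> {1, -1}"
    "det (kasteleyn_matrix G l b w) = \<delta> * det (edge_matrix (signed_weight G) n b' w')"
    using det_edge_matrix_renumber[OF assms(5) b'[unfolded \<open>n = l\<close>] assms(6) w'[unfolded \<open>n = l\<close>]]
    unfolding kasteleyn_matrix_eq_edge_matrix[OF assms(5,6)] by blast
  then have "det (kasteleyn_matrix G l b w) =
      (\<delta> * (- 1) ^ Suc (length G) * \<epsilon>) * q_var powi k * to_fract R"
    unfolding det N(2) by (simp only: mult.assoc)
  moreover have "\<delta> * (- 1) ^ Suc (length G) * \<epsilon> \<in> {1, -1}"
    using \<open>\<delta> \<in> {1, -1}\<close> N(1) by (cases "even (length G)") auto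
  ultimately show ?thesis by blast
qed

end
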